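(* Consider the frozen-phase process $(N^+(T_n),\eta_2(\cdot,T_n))_{n\ge0}$ and the label sets $\mathcal A_1,\dots,\mathcal A_4\subset\{1,\dots,N\}$ defined in the context. For disjoint sets $S_-,S_+\subset\{1,\dots,N\}$ put $g(0)=1$ and, for $1\le \ell\le N$, $$g(\ell)=\binom N\ell\prod_{j=0}^{\ell-1}\frac{1-q\bar P_{--}(j)-(1-q)\chi_{S_-}(j)}{1-q\bar P_{++}(j+1)-(1-q)\chi_{S_+}(j+1)},\qquad Z(N)=\sum_{i=1}^N g(i),$$ $$\pi_\infty(\ell)=\frac{g(\ell)}{1+Z(N)}\ \text{ for } 0\le\ell\le N,\qquad \pi_\infty(\ell)=0\ \text{ otherwise},$$ where $\chi_S$ denotes the indicator function of $S$. (a) If $\mathcal A_2\cup\mathcal A_3=\emptyset$, there is a unique invariant measure for $N^+$, and it is the measure $\pi_\infty$ above with $S_-=\mathcal A_4$ and $S_+=\mathcal A_1$. (b) If $\mathcal A_3=\emptyset$ but $\mathcal A_2\neq\emptyset$, the invariant measure is not unique, because $\eta_2(\cdot,\infty)$ on $\mathcal A_2$ depends on $\eta_2(\cdot,0)$. Any measure $\pi_\infty$ of the form above with $S_-=\mathcal A_4\cup\{i\in\mathcal A_2:\eta_2(\varphi^{-1}(i),0)=-1\}$ and $S_+=\mathcal A_1\cup\{i\in\mathcal A_2:\eta_2(\varphi^{-1}(i),0)=+1\}$ is invariant under the two-dimensional spin process. Thus there are $2^{|\mathcal A_2|}$ different invariant measures, one for each assignment of $\pm1$ to the second spin of the points in $\mathcal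 A_2$. (c) If $\mathcal A_3\neq\emptyset$, no invariant measure exists for the two-dimensional spin process (because $\eta_2$ never settles at the points of $\mathcal A_3$).
   Context: Parameters: integers $d\ge 1$ and $N\ge 2d+1$, reals $\alpha>0$, $\gamma\le 0$, $q\in(0,1]$. $Y$ is a finite set of $N$ sites (agents) and $\varphi:Y\to\{1,\dots,N\}$ is a fixed bijection; subsets of $\{1,\dots,N\}$ and of $Y$ are identified through $\varphi$. A state is a configuration $x\mapsto(\eta_1(x),\eta_2(x))\in\{-1,1\}^2$, $x\in Y$. The process is constant between epochs $0=T_0<T_1<T_2<\cdots$ with i.i.d. rate-1 exponential spacings. $N^+(t)$ is the number of $x\in Y$ with $\eta_1(x,t)=+1$. Hamiltonian flip probabilities in the frozen phase (inverse temperature $\beta\to\infty$). For $0\le i\le N$ put $c=c(i)=\lceil \alpha|i/N-1/2|\rceil$. For $1\le i\le N$ set $$\bar P_{++}(i)=\sum_{j=\max(d+c,\,i+2d-N)}^{\min(2d,\,i)}\binom{i-1}{j}\binom{N-i}{2d-j}\Big/\binom{N-1}{2d}$$ if $i\in[N(\tfrac12-\tfrac d\alpha),N(\tfrac12+\tfrac d\alpha)]$, and $\bar P_{++}(i)=0$ otherwise. For $0\le i\le N-1$ set $$\bar P_{--}(i)=\sum_{j=\max(0,\,i+2d-N)}^{\min(d-c,\,i)}\binom{i}{j}\binom{N-i-1}{2d-j}\Big/\binom{N-1}{2d}$$ if $i$ lies in the same interval, and $\bar P_{--}(i)=0$ otherwise. Empty sums are $0$, and binomials $\binom nk$ with $k<0$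 or $k>n$ are $0$. Define $\mathcal E_+(i)=(1-\frac iN)(1-\bar P_{--}(i))+\gamma\frac iN(1-\bar P_{++}(i))$ for $1\le i\le N$ (first term $0$ when $i=N$). Let $$\mathcal B=\Big\{i\in\{1,\dots,N\}:\mathcal E_+(i)\ge\Big(1-\frac1q\Big)\Big(1-\frac iN\Big)\Big\},\qquad \mathcal C=\Big\{i\in\{1,\dots,N\}:\mathcal E_+(i)\le\Big(1-\frac1q\Big)\frac iN\Big\},$$ and, with complements in $\{1,\dots,N\}$, $\mathcal A_1=\mathcal B\cap\mathcal C^c$, $\mathcal A_2=\mathcal B\cap\mathcal C$, $\mathcal A_3=\mathcal B^c\cap\mathcal C^c$, $\mathcal A_4=\mathcal B^c\cap\mathcal C$. Dynamics of the second spin: at each epoch $T_n$, $n\ge1$, all sites update synchronously and deterministically. If $\eta_2(x,T_{n-1})=1$, then $\eta_2(x,T_n)=1$ when $\varphi(x)\in\mathcal B$ and $-1$ otherwise; if $\eta_2(x,T_{n-1})=-1$, then $\eta_2(x,T_n)=-1$ when $\varphi(x)\in\mathcal C$ and $+1$ otherwise. Dynamics of the first spin: at each $T_n$ a uniformly random site $J_n\in Y$ is chosen and only its first spin may flip. Consequently, conditionally on the history up to $T_{n-1}$ with $N^+(T_{n-1})=i$, and writing $s=\eta_2(\varphi^{-1}(i),T_n)\in\{-1,1\}$ for $1\le i\le N$ (with the convention $s=+1$ when $i=0$), $$\Pr\big(N^+(T_n)=i+1\big)=\Big(1-\frac iN\Big)\Big\{q\big(1-\bar P_{--}(i)\big)+(1-q)\frac{1+s}2\Big\},$$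 $$\Pr\big(N^+(T_n)=i-1\big)=\frac iN\Big\{q\big(1-\bar P_{++}(i)\big)+(1-q)\frac{1-s}2\Big\},$$ and otherwise $N^+(T_n)=i$. Invariant measure: the term refers to the limiting law $\pi_\infty(\ell)=\lim_{n\to\infty}\Pr(N^+(T_n)=\ell)$ of the frozen-phase process. It is unique if it does not depend on the initial condition, non-unique if it depends on $\eta_2(\cdot,0)$, and non-existent if the limit does not exist. $\eta_2(\cdot,\infty)$ denotes the eventual value of $\eta_2$.
   Formalization: Claims on π_∞ assume no denominator of g vanishes (i.e. α>2d); limit claims exclude q=1 with all flip probabilities P̄ zero (period 2); distinctness of the N⁺ laws in (b) assumes q<1 (joint laws are counted for q=1); in (c) the N⁺ law is treated only for α>2d, the pair always. *)

theory Defs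
  imports "HOL-Probability.Probability"
begin

section \<open>Flip probabilities of the frozen phase\<close>

definition thr :: "nat \<Rightarrow> real \<Rightarrow> nat \<Rightarrow> int" where
  "thr N \<alpha> i = \<lceil>\<alpha> * \<bar>real i / real N - 1/2\<bar>\<rceil>"

definition window :: "nat \<Rightarrow> nat \<Rightarrow> real \<Rightarrow> real set" where
  "window N d \<alpha> = {real N * (1/2 - real d / \<alpha>) .. real N * (1/2 + real d / \<alpha>)}"

text \<open>The summation bounds may be negative, so they are compared as integers.
  \<open>Pbar_pp\<close> is only used for \<open>1 \<le> i \<le> N\<close> and \<open>Pbar_mm\<close> for \<open>i < N\<close>: elsewhere it is
  multiplied by \<open>i / N = 0\<close> or \<open>1 - i / N = 0\<close>, or occurs under a Bernoulli
  choice of probability 0.\<close>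

definition Pbar_pp :: "nat \<Rightarrow> nat \<Rightarrow> real \<Rightarrow> nat \<Rightarrow> real" where
  "Pbar_pp N d \<alpha> i =
    (if real i \<in> window N d \<alpha> then
       (\<Sum>j \<in> {j::nat. max (int d + thr N \<alpha> i) (int i + 2 * int d - int N) \<le> int j \<and>
                       int j \<le> min (2 * int d) (int i)}.
          real ((i - 1) choose j) * real ((N - i) choose (2 * d - j)))
       / real ((N - 1) choose (2 * d))
     else 0)"

definition Pbar_mm :: "nat \<Rightarrow> nat \<Rightarrow> real \<Rightarrow> nat \<Rightarrow> real" where
  "Pbar_mm N d \<alpha> i =
    (if real i \<in> window N d \<alpha> then
       (\<Sum>j \<in> {j::nat. max 0 (int i + 2 * int d - int N) \<le> int j \<and>
                       int j \<le> min (int d - thr N \<alpha> i) (int i)}.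
          real (i choose j) * real ((N - i - 1) choose (2 * d - j)))
       / real ((N - 1) choose (2 * d))
     else 0)"

section \<open>Labels\<close>

definition E_plus :: "nat \<Rightarrow> nat \<Rightarrow> real \<Rightarrow> real \<Rightarrow> nat \<Rightarrow> real" where
  "E_plus N d \<alpha> \<gamma> i =
    (1 - real i / real N) * (1 - Pbar_mm N d \<alpha> i)
    + \<gamma> * (real i / real N) * (1 - Pbar_pp N d \<alpha> i)"

definition B_set :: "nat \<Rightarrow> nat \<Rightarrow> real \<Rightarrow> real \<Rightarrow> real \<Rightarrow> nat set" where
  "B_set N d \<alpha> \<gamma> q =
    {i \<in> {1..N}. E_plus N d \<alpha> \<gamma> i \<ge> (1 - 1 / q) * (1 - real i / real N)}"

definition C_set :: "nat \<Rightarrow> nat \<Rightarrow> real \<Rightarrow> real \<Rightarrow> real \<Rightarrow> nat set" where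
  "C_set N d \<alpha> \<gamma> q =
    {i \<in> {1..N}. E_plus N d \<alpha> \<gamma> i \<le> (1 - 1 / q) * (real i / real N)}"

definition A1 :: "nat \<Rightarrow> nat \<Rightarrow> real \<Rightarrow> real \<Rightarrow> real \<Rightarrow> nat set" where
  "A1 N d \<alpha> \<gamma> q = B_set N d \<alpha> \<gamma> q \<inter> ({1..N} - C_set N d \<alpha> \<gamma> q)"

definition A2 :: "nat \<Rightarrow> nat \<Rightarrow> real \<Rightarrow> real \<Rightarrow> real \<Rightarrow> nat set" where
  "A2 N d \<alpha> \<gamma> q = B_set N d \<alpha> \<gamma> q \<inter> C_set N d \<alpha> \<gamma> q"

definition A3 :: "nat \<Rightarrow> nat \<Rightarrow> real \<Rightarrow> real \<Rightarrow> real \<Rightarrow> nat set" where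
  "A3 N d \<alpha> \<gamma> q = ({1..N} - B_set N d \<alpha> \<gamma> q) \<inter> ({1..N} - C_set N d \<alpha> \<gamma> q)"

definition A4 :: "nat \<Rightarrow> nat \<Rightarrow> real \<Rightarrow> real \<Rightarrow> real \<Rightarrow> nat set" where
  "A4 N d \<alpha> \<gamma> q = ({1..N} - B_set N d \<alpha> \<gamma> q) \<inter> C_set N d \<alpha> \<gamma> q"

section \<open>The frozen-phase process at the epochs\<close>

definition spin_configs :: "('y \<Rightarrow> int) set" where
  "spin_configs = {\<eta>. \<forall>x. \<eta> x \<in> {-1, 1}}"

definition eta2_step ::
  "nat \<Rightarrow> nat \<Rightarrow> real \<Rightarrow> real \<Rightarrow> real \<Rightarrow> ('y \<Rightarrow> nat) \<Rightarrow> ('y \<Rightarrow> int) \<Rightarrow> 'y \<Rightarrow> int" where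
  "eta2_step N d \<alpha> \<gamma> q \<phi> \<eta> x =
    (if \<eta> x = 1 then (if \<phi> x \<in> B_set N d \<alpha> \<gamma> q then 1 else -1)
     else (if \<phi> x \<in> C_set N d \<alpha> \<gamma> q then -1 else 1))"

text \<open>\<open>eta2_at \<dots> \<eta> n\<close> is the second spin at the \<open>n\<close>-th epoch, started from \<open>\<eta>\<close>.\<close>

definition eta2_at ::
  "nat \<Rightarrow> nat \<Rightarrow> real \<Rightarrow> real \<Rightarrow> real \<Rightarrow> ('y \<Rightarrow> nat) \<Rightarrow> ('y \<Rightarrow> int) \<Rightarrow> nat \<Rightarrow> 'y \<Rightarrow> int" where
  "eta2_at N d \<alpha> \<gamma> q \<phi> \<eta> n = (eta2_step N d \<alpha> \<gamma> q \<phi> ^^ n) \<eta>"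

text \<open>One step of \<open>N\<^sup>+\<close> from \<open>i\<close>. The first Bernoulli choice is the sign of the first spin of
  the uniformly chosen site, the second one is whether this spin flips. The resulting
  transition probabilities are computed in \<open>pmf_Nplus_step_up\<close> and \<open>pmf_Nplus_step_down\<close>
  below.\<close>

definition Nplus_step :: "nat \<Rightarrow> nat \<Rightarrow> real \<Rightarrow> real \<Rightarrow> nat \<Rightarrow> int \<Rightarrow> nat pmf" where
  "Nplus_step N d \<alpha> q i s =
    bind_pmf (bernoulli_pmf (real i / real N)) (\<lambda>plus.
      if plus then
        map_pmf (\<lambda>flip. if flip then i - 1 else i)
          (bernoulli_pmf (q * (1 - Pbar_pp N d \<alpha> i) + (1 - q) * (1 - of_int s) / 2))
      else
        map_pmf (\<lambda>flip. if flip then i + 1 else i)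
          (bernoulli_pmf (q * (1 - Pbar_mm N d \<alpha> i) + (1 - q) * (1 + of_int s) / 2)))"

text \<open>The first spin uses the already updated second spin of the site labelled by the current
  value of \<open>N\<^sup>+\<close>, or \<open>+1\<close> if that value is 0.\<close>

definition frozen_step ::
  "nat \<Rightarrow> nat \<Rightarrow> real \<Rightarrow> real \<Rightarrow> real \<Rightarrow> ('y \<Rightarrow> nat) \<Rightarrow>
   nat \<times> ('y \<Rightarrow> int) \<Rightarrow> (nat \<times> ('y \<Rightarrow> int)) pmf" where
  "frozen_step N d \<alpha> \<gamma> q \<phi> = (\<lambda>(i, \<eta>).
     let \<eta>' = eta2_step N d \<alpha> \<gamma> q \<phi> \<eta>;
         s = (if i = 0 then 1 else \<eta>' (inv \<phi> i))
     in map_pmf (\<lambda>i'. (i', \<eta>')) (Nplus_step N d \<alpha> q i s))"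

text \<open>\<open>frozen_law \<dots> k \<eta> n\<close> is the law of \<open>(N\<^sup>+(T\<^sub>n), \<eta>\<^sub>2(\<cdot>, T\<^sub>n))\<close> started from \<open>(k, \<eta>)\<close>.\<close>

primrec frozen_law ::
  "nat \<Rightarrow> nat \<Rightarrow> real \<Rightarrow> real \<Rightarrow> real \<Rightarrow> ('y \<Rightarrow> nat) \<Rightarrow>
   nat \<Rightarrow> ('y \<Rightarrow> int) \<Rightarrow> nat \<Rightarrow> (nat \<times> ('y \<Rightarrow> int)) pmf" where
  "frozen_law N d \<alpha> \<gamma> q \<phi> k \<eta> 0 = return_pmf (k, \<eta>)"
| "frozen_law N d \<alpha> \<gamma> q \<phi> k \<eta> (Suc n) =
     bind_pmf (frozen_law N d \<alpha> \<gamma> q \<phi> k \<eta> n) (frozen_step N d \<alpha> \<gamma> q \<phi>)"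

section \<open>Invariant measures\<close>

text \<open>Limiting laws of \<open>N\<^sup>+\<close> and of the pair, for the process started from \<open>(k, \<eta>)\<close>. As the
  process stays in a finite set, pointwise convergence is convergence in law.\<close>

definition Nplus_limit_law ::
  "nat \<Rightarrow> nat \<Rightarrow> real \<Rightarrow> real \<Rightarrow> real \<Rightarrow> ('y \<Rightarrow> nat) \<Rightarrow>
   nat \<Rightarrow> ('y \<Rightarrow> int) \<Rightarrow> (nat \<Rightarrow> real) \<Rightarrow> bool" where
  "Nplus_limit_law N d \<alpha> \<gamma> q \<phi> k \<eta> p \<longleftrightarrow>
    (\<forall>l. (\<lambda>n. pmf (map_pmf fst (frozen_law N d \<alpha> \<gamma> q \<phi> k \<eta> n)) l) \<longlonglongrightarrow> p l)"

definition joint_limit_law ::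
  "nat \<Rightarrow> nat \<Rightarrow> real \<Rightarrow> real \<Rightarrow> real \<Rightarrow> ('y \<Rightarrow> nat) \<Rightarrow>
   nat \<Rightarrow> ('y \<Rightarrow> int) \<Rightarrow> (nat \<times> ('y \<Rightarrow> int) \<Rightarrow> real) \<Rightarrow> bool" where
  "joint_limit_law N d \<alpha> \<gamma> q \<phi> k \<eta> p \<longleftrightarrow>
    (\<forall>z. (\<lambda>n. pmf (frozen_law N d \<alpha> \<gamma> q \<phi> k \<eta> n) z) \<longlonglongrightarrow> p z)"

definition Nplus_limit_laws ::
  "nat \<Rightarrow> nat \<Rightarrow> real \<Rightarrow> real \<Rightarrow> real \<Rightarrow> ('y \<Rightarrow> nat) \<Rightarrow> (nat \<Rightarrow> real) set" where
  "Nplus_limit_laws N d \<alpha> \<gamma> q \<phi> =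
    {p. \<exists>k\<le>N. \<exists>\<eta>\<in>spin_configs. Nplus_limit_law N d \<alpha> \<gamma> q \<phi> k \<eta> p}"

definition joint_limit_laws ::
  "nat \<Rightarrow> nat \<Rightarrow> real \<Rightarrow> real \<Rightarrow> real \<Rightarrow> ('y \<Rightarrow> nat) \<Rightarrow> (nat \<times> ('y \<Rightarrow> int) \<Rightarrow> real) set" where
  "joint_limit_laws N d \<alpha> \<gamma> q \<phi> =
    {p. \<exists>k\<le>N. \<exists>\<eta>\<in>spin_configs. joint_limit_law N d \<alpha> \<gamma> q \<phi> k \<eta> p}"

definition stationary ::
  "nat \<Rightarrow> nat \<Rightarrow> real \<Rightarrow> real \<Rightarrow> real \<Rightarrow> ('y \<Rightarrow> nat) \<Rightarrow> (nat \<times> ('y \<Rightarrow> int)) pmf \<Rightarrow> bool" where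
  "stationary N d \<alpha> \<gamma> q \<phi> \<mu> \<longleftrightarrow>
    set_pmf \<mu> \<subseteq> {0..N} \<times> spin_configs \<and> bind_pmf \<mu> (frozen_step N d \<alpha> \<gamma> q \<phi>) = \<mu>"

section \<open>The measures \<open>\<pi>\<^sub>\<infinity>\<close>\<close>

definition g_weight :: "nat \<Rightarrow> nat \<Rightarrow> real \<Rightarrow> real \<Rightarrow> nat set \<Rightarrow> nat set \<Rightarrow> nat \<Rightarrow> real" where
  "g_weight N d \<alpha> q Sm Sp l =
    real (N choose l) *
    (\<Prod>j<l. (1 - q * Pbar_mm N d \<alpha> j - (1 - q) * indicator Sm j) /
            (1 - q * Pbar_pp N d \<alpha> (j + 1) - (1 - q) * indicator Sp (j + 1)))"

text \<open>The formula for \<open>g\<close> is meaningful only if none of its denominators vanishes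
  (division by 0 would silently give 0).\<close>

definition g_defined :: "nat \<Rightarrow> nat \<Rightarrow> real \<Rightarrow> real \<Rightarrow> nat set \<Rightarrow> bool" where
  "g_defined N d \<alpha> q Sp \<longleftrightarrow>
    (\<forall>i\<in>{1..N}. 1 - q * Pbar_pp N d \<alpha> i - (1 - q) * indicator Sp i \<noteq> 0)"

definition Z_sum :: "nat \<Rightarrow> nat \<Rightarrow> real \<Rightarrow> real \<Rightarrow> nat set \<Rightarrow> nat set \<Rightarrow> real" where
  "Z_sum N d \<alpha> q Sm Sp = (\<Sum>i=1..N. g_weight N d \<alpha> q Sm Sp i)"

definition pi_inf :: "nat \<Rightarrow> nat \<Rightarrow> real \<Rightarrow> real \<Rightarrow> nat set \<Rightarrow> nat set \<Rightarrow> nat \<Rightarrow> real" where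
  "pi_inf N d \<alpha> q Sm Sp l =
    (if l \<le> N then g_weight N d \<alpha> q Sm Sp l / (1 + Z_sum N d \<alpha> q Sm Sp) else 0)"

text \<open>The sets \<open>S\<^sub>-\<close> and \<open>S\<^sub>+\<close> determined by an assignment \<open>\<sigma>\<close> of second spins to the labels
  in \<open>A2\<close>.\<close>

definition S_minus :: "nat \<Rightarrow> nat \<Rightarrow> real \<Rightarrow> real \<Rightarrow> real \<Rightarrow> (nat \<Rightarrow> int) \<Rightarrow> nat set" where
  "S_minus N d \<alpha> \<gamma> q \<sigma> = A4 N d \<alpha> \<gamma> q \<union> {i \<in> A2 N d \<alpha> \<gamma> q. \<sigma> i = -1}"

definition S_plus :: "nat \<Rightarrow> nat \<Rightarrow> real \<Rightarrow> real \<Rightarrow> real \<Rightarrow> (nat \<Rightarrow> int) \<Rightarrow> nat set" where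
  "S_plus N d \<alpha> \<gamma> q \<sigma> = A1 N d \<alpha> \<gamma> q \<union> {i \<in> A2 N d \<alpha> \<gamma> q. \<sigma> i = 1}"

text \<open>The eventual second spin when \<open>A3\<close> is empty.\<close>

definition settled ::
  "nat \<Rightarrow> nat \<Rightarrow> real \<Rightarrow> real \<Rightarrow> real \<Rightarrow> ('y \<Rightarrow> nat) \<Rightarrow> ('y \<Rightarrow> int) \<Rightarrow> 'y \<Rightarrow> int" where
  "settled N d \<alpha> \<gamma> q \<phi> \<eta> x =
    (if \<phi> x \<in> A1 N d \<alpha> \<gamma> q then 1 else if \<phi> x \<in> A4 N d \<alpha> \<gamma> q then -1 else \<eta> x)"

text \<open>The joint law \<open>\<pi>\<^sub>\<infinity> \<otimes> \<delta>\<close> attached to the initial second spins \<open>\<eta>\<close>.\<close>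

definition joint_inf ::
  "nat \<Rightarrow> nat \<Rightarrow> real \<Rightarrow> real \<Rightarrow> real \<Rightarrow> ('y \<Rightarrow> nat) \<Rightarrow> ('y \<Rightarrow> int) \<Rightarrow>
   nat \<times> ('y \<Rightarrow> int) \<Rightarrow> real" where
  "joint_inf N d \<alpha> \<gamma> q \<phi> \<eta> = (\<lambda>(l, \<zeta>).
     pi_inf N d \<alpha> q (S_minus N d \<alpha> \<gamma> q (\<lambda>i. \<eta> (inv \<phi> i))) (S_plus N d \<alpha> \<gamma> q (\<lambda>i. \<eta> (inv \<phi> i))) l
     * of_bool (\<zeta> = settled N d \<alpha> \<gamma> q \<phi> \<eta>))"

text \<open>For \<open>q = 1\<close> and \<open>N\<close> odd, all flip probabilities can equal 1. Then \<open>N\<^sup>+\<close> moves at every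
  epoch, hence has period 2, and its law at the epochs cannot converge. The following
  condition excludes exactly this case.\<close>

definition not_alternating :: "nat \<Rightarrow> nat \<Rightarrow> real \<Rightarrow> real \<Rightarrow> bool" where
  "not_alternating N d \<alpha> q \<longleftrightarrow> (q = 1 \<longrightarrow> (\<exists>i\<in>{1..N}. Pbar_pp N d \<alpha> i \<noteq> 0))"

section \<open>The transition probabilities\<close>

lemma vandermonde_partial:
  assumes "finite J" "J \<subseteq> {..r}"
  shows "(\<Sum>j\<in>J. real (m choose j) * real (n choose (r - j))) \<le> real ((m + n) choose r)"
proof -
  have "(\<Sum>j\<in>J. real (m choose j) * real (n choose (r - j)))
        \<le> (\<Sum>j\<le>r. real (m choose j) * real (n choose (r - j)))"
    using assms by (intro sum_mono2) auto
  also have "\<dots> = real (\<Sum>j\<le>r. (m choose j) * (n choose (r - j)))" by simp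
  also have "\<dots> = real ((m + n) choose r)" by (simp only: vandermonde)
  finally show ?thesis .
qed

lemma thr_nonneg: "\<alpha> > 0 \<Longrightarrow> thr N \<alpha> i \<ge> 0"
  by (simp add: thr_def) (smt (verit) mult_nonneg_nonneg)

lemma Pbar_pp_unit:
  assumes "1 \<le> i" "i \<le> N"
  shows "Pbar_pp N d \<alpha> i \<in> {0..1}"
proof -
  let ?J = "{j::nat. max (int d + thr N \<alpha> i) (int i + 2 * int d - int N) \<le> int j \<and>
                     int j \<le> min (2 * int d) (int i)}"
  have J: "?J \<subseteq> {..2 * d}" by auto
  then have "finite ?J" by (rule finite_subset) simp
  then have "(\<Sum>j\<in>?J. real ((i - 1) choose j) * real ((N - i) choose (2 * d - j)))
      \<le> real ((i - 1 + (N - i)) choose (2 * d))"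
    using J by (rule vandermonde_partial)
  also have "i - 1 + (N - i) = N - 1" using assms by simp
  finally show ?thesis
    unfolding Pbar_pp_def by (auto intro!: sum_nonneg divide_nonneg_nonneg simp: divide_le_eq)
qed

lemma Pbar_mm_unit:
  assumes "i < N" "\<alpha> > 0"
  shows "Pbar_mm N d \<alpha> i \<in> {0..1}"
proof -
  let ?J = "{j::nat. max 0 (int i + 2 * int d - int N) \<le> int j \<and>
                     int j \<le> min (int d - thr N \<alpha> i) (int i)}"
  have J: "?J \<subseteq> {..2 * d}" using thr_nonneg[OF assms(2), of N i] by auto
  then have "finite ?J" by (rule finite_subset) simp
  then have "(\<Sum>j\<in>?J. real (i choose j) * real ((N - i - 1) choose (2 * d - j)))
      \<le> real ((i + (N - i - 1)) choose (2 * d))"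
    using J by (rule vandermonde_partial)
  also have "i + (N - i - 1) = N - 1" using assms by simp
  finally show ?thesis
    unfolding Pbar_mm_def by (auto intro!: sum_nonneg divide_nonneg_nonneg simp: divide_le_eq)
qed

lemma unit_mix:
  fixes q a b :: real
  assumes "0 \<le> q" "q \<le> 1" "a \<in> {0..1}" "b \<in> {0..1}"
  shows "q * (1 - a) + (1 - q) * b \<in> {0..1}"
proof -
  have "q * (1 - a) \<le> q" "(1 - q) * b \<le> 1 - q"
    using assms by (auto simp: mult_left_le)
  moreover have "0 \<le> q * (1 - a)" "0 \<le> (1 - q) * b" using assms by auto
  ultimately show ?thesis by auto
qed

lemma pmf_flip:
  assumes "p \<in> {0..1}" "a \<noteq> b"
  shows "pmf (map_pmf (\<lambda>flip. if flip then a else b) (bernoulli_pmf p)) a = p"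
  using assms by (simp add: map_pmf_def pmf_bind indicator_def)

lemma pmf_flip_other:
  assumes "c \<noteq> a" "c \<noteq> b"
  shows "pmf (map_pmf (\<lambda>flip. if flip then a else b) (bernoulli_pmf p)) c = 0"
  using assms by (auto simp: pmf_eq_0_set_pmf split: if_splits)

lemma pmf_Nplus_step_up:
  assumes "\<alpha> > 0" "0 < q" "q \<le> 1" "i < N" "s \<in> {-1, 1}"
  shows "pmf (Nplus_step N d \<alpha> q i s) (i + 1) =
    (1 - real i / real N) * (q * (1 - Pbar_mm N d \<alpha> i) + (1 - q) * ((1 + of_int s) / 2))"
proof -
  have *: "q * (1 - Pbar_mm N d \<alpha> i) + (1 - q) * (1 + of_int s) / 2 \<in> {0..1}"
    using assms Pbar_mm_unit[of i N \<alpha> d] unit_mix[of q "Pbar_mm N d \<alpha> i" "(1 + of_int s) / 2"]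
    by auto
  show ?thesis
    using assms pmf_flip[OF *, of "i + 1" i] pmf_flip_other[of "i + 1" "i - 1" i]
    by (simp add: Nplus_step_def pmf_bind)
qed

lemma pmf_Nplus_step_down:
  assumes "0 < q" "q \<le> 1" "1 \<le> i" "i \<le> N" "s \<in> {-1, 1}"
  shows "pmf (Nplus_step N d \<alpha> q i s) (i - 1) =
    (real i / real N) * (q * (1 - Pbar_pp N d \<alpha> i) + (1 - q) * ((1 - of_int s) / 2))"
proof -
  have *: "q * (1 - Pbar_pp N d \<alpha> i) + (1 - q) * (1 - of_int s) / 2 \<in> {0..1}"
    using assms Pbar_pp_unit[of i N d \<alpha>] unit_mix[of q "Pbar_pp N d \<alpha> i" "(1 - of_int s) / 2"]
    by auto
  show ?thesis
    using assms pmf_flip[OF *, of "i - 1" i] pmf_flip_other[of "i - 1" "i + 1" i]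
    by (simp add: Nplus_step_def pmf_bind)
qed

lemma set_pmf_Nplus_step: "set_pmf (Nplus_step N d \<alpha> q i s) \<subseteq> {i - 1, i, i + 1}"
  by (auto simp: Nplus_step_def split: if_splits)

end

theory Submission
  imports Defs
begin

text \<open>The second spins evolve deterministically and label by label. On \<open>A\<^sub>1\<close> and \<open>A\<^sub>4\<close> one update makes
  them \<open>1\<close> and \<open>-1\<close>, on \<open>A\<^sub>2\<close> they never change, and on \<open>A\<^sub>3\<close> they change at every epoch.

  If \<open>A\<^sub>3\<close> is empty, then \<open>N\<^sup>+\<close> is a homogeneous birth-and-death chain on \<open>{0..N}\<close> from the first epoch
  on (\<open>law_settled\<close>). Its stationary laws are those for which the flows across every cut balance
  (\<open>stationary_imp_balance\<close>, \<open>balance_imp_stationary\<close>), and \<open>g\<close> solves the balance equations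
  (\<open>g_balance\<close>). When \<open>g\<close> is defined, all downward rates are positive; this makes the balanced law unique
  and lets the chain reach 0 from every state. A state reachable from 0 at which
  the chain can wait excludes periodicity; it exists unless the chain moves at every epoch
  (\<open>waiting_state\<close>). Then 0 is reached from all states in the same number of steps, and Doeblin's
  contraction argument (\<open>l1_dist_bind_le\<close>, \<open>law_after_converges\<close>) gives convergence.

  The balance equations also show how a law determines the second spins (\<open>balance_determines_spins\<close>): for
  \<open>q < 1\<close>, knowing the second spin at \<open>i\<close> gives the upward rate at \<open>i\<close>, then the downward rate at \<open>i + 1\<close>,
  and then the second spin at \<open>i + 1\<close>. This needs a law that is positive everywhere. When \<open>g\<close> is
  defined for every assignment, positivity follows from the reflection symmetry between the two flip
  probabilities (\<open>Pbar_pp_reflect\<close>): an upward rate 0 at \<open>l\<close> would cause a denominator 0 at \<open>N - l\<close>.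
  So different assignments on \<open>A\<^sub>2\<close> have different limits.

  If \<open>A\<^sub>3\<close> is not empty, the joint law cannot converge, as its second component never repeats at two
  consecutive epochs (\<open>no_joint_limit\<close>). For \<open>N\<^sup>+\<close> alone let \<open>\<alpha> > 2 d\<close>. The kernel of \<open>N\<^sup>+\<close> alternates
  between two kernels, all of whose rates are positive (\<open>Pbar_mm_less_1\<close>). A limit law would be balanced for both, and the
  balance argument above would make their second spins equal (\<open>no_Nplus_limit\<close>).\<close>

section \<open>Convergence of finite Markov chains\<close>

definition law_after :: "('a \<Rightarrow> 'a pmf) \<Rightarrow> nat \<Rightarrow> 'a pmf \<Rightarrow> 'a pmf" where
  "law_after K n \<mu> = ((\<lambda>\<nu>. bind_pmf \<nu> K) ^^ n) \<mu>"

lemma law_after_0 [simp]: "law_after K 0 \<mu> = \<mu>"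
  by (simp add: law_after_def)

lemma law_after_Suc: "law_after K (Suc n) \<mu> = bind_pmf (law_after K n \<mu>) K"
  by (simp add: law_after_def)

lemma law_after_bind: "law_after K n (bind_pmf \<mu> f) = bind_pmf \<mu> (\<lambda>x. law_after K n (f x))"
  by (induction n) (simp_all add: law_after_Suc bind_assoc_pmf)

lemma law_after_add: "law_after K (m + n) \<mu> = law_after K m (law_after K n \<mu>)"
  by (simp add: law_after_def funpow_add)

text \<open>The \<open>n\<close>-step law is one step of a chain with the \<open>n\<close>-step kernel. This turns a one-step
  contraction into an \<open>n\<close>-step one.\<close>

lemma law_after_as_kernel:
  "law_after K n \<mu> = bind_pmf \<mu> (\<lambda>x. law_after K n (return_pmf x))"
  by (metis law_after_bind bind_return_pmf')

lemma law_after_path: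
  assumes "y \<in> set_pmf (law_after K m (return_pmf x))"
    and "z \<in> set_pmf (law_after K n (return_pmf y))"
  shows "z \<in> set_pmf (law_after K (n + m) (return_pmf x))"
  using assms by (subst law_after_add, subst law_after_as_kernel) auto

lemma law_after_1: "law_after K (Suc 0) (return_pmf x) = K x"
  by (simp add: law_after_Suc bind_return_pmf)

lemma law_after_invariant: "bind_pmf \<pi> K = \<pi> \<Longrightarrow> law_after K n \<pi> = \<pi>"
  by (induction n) (simp_all add: law_after_Suc)

lemma set_law_after:
  assumes "\<And>x. x \<in> S \<Longrightarrow> set_pmf (K x) \<subseteq> S" "set_pmf \<mu> \<subseteq> S"
  shows "set_pmf (law_after K n \<mu>) \<subseteq> S"
  using assms by (induction n) (auto simp: law_after_Suc)

lemma pmf_bind_finite: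
  assumes "finite S" "set_pmf \<mu> \<subseteq> S"
  shows "pmf (bind_pmf \<mu> K) y = (\<Sum>x\<in>S. pmf \<mu> x * pmf (K x) y)"
  using assms by (subst pmf_bind, subst integral_measure_pmf_real[of S]) (auto simp: mult.commute)

definition l1_dist :: "'a set \<Rightarrow> 'a pmf \<Rightarrow> 'a pmf \<Rightarrow> real" where
  "l1_dist S \<mu> \<nu> = (\<Sum>y\<in>S. \<bar>pmf \<mu> y - pmf \<nu> y\<bar>)"

text \<open>Doeblin's argument: subtracting \<open>\<epsilon>\<close> from the entries \<open>K x z\<close> does not change the image
  of a signed measure of total mass 0, and leaves a nonnegative matrix with row sums \<open>1 - \<epsilon>\<close>.\<close>

lemma l1_dist_bind_le:
  assumes S: "finite S" "z \<in> S" "set_pmf \<mu> \<subseteq> S" "set_pmf \<nu> \<subseteq> S"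
    and K: "\<And>x. x \<in> S \<Longrightarrow> set_pmf (K x) \<subseteq> S" "\<And>x. x \<in> S \<Longrightarrow> \<epsilon> \<le> pmf (K x) z"
  shows "l1_dist S (bind_pmf \<mu> K) (bind_pmf \<nu> K) \<le> (1 - \<epsilon>) * l1_dist S \<mu> \<nu>"
proof -
  define v where "v x = pmf \<mu> x - pmf \<nu> x" for x
  define R where "R x y = pmf (K x) y - (if y = z then \<epsilon> else 0)" for x y
  have v0: "(\<Sum>x\<in>S. v x) = 0"
    using S by (simp add: v_def sum_subtractf sum_pmf_eq_1)
  have R: "0 \<le> R x y" if "x \<in> S" for x y
    using K(2)[OF that] by (simp add: R_def)
  have rows: "(\<Sum>y\<in>S. R x y) = 1 - \<epsilon>" if "x \<in> S" for x
    using S K(1)[OF that] by (simp add: R_def sum_subtractf sum_pmf_eq_1)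
  have diff: "pmf (bind_pmf \<mu> K) y - pmf (bind_pmf \<nu> K) y = (\<Sum>x\<in>S. v x * R x y)" for y
  proof -
    have "(\<Sum>x\<in>S. v x * R x y)
        = (\<Sum>x\<in>S. v x * pmf (K x) y) - (\<Sum>x\<in>S. v x) * (if y = z then \<epsilon> else 0)"
      by (simp add: R_def right_diff_distrib sum_subtractf sum_distrib_right)
    also have "\<dots> = (\<Sum>x\<in>S. v x * pmf (K x) y)"
      by (simp add: v0)
    also have "\<dots> = pmf (bind_pmf \<mu> K) y - pmf (bind_pmf \<nu> K) y"
      using S by (simp add: pmf_bind_finite[of S] v_def left_diff_distrib sum_subtractf)
    finally show ?thesis by simp
  qed
  have "l1_dist S (bind_pmf \<mu> K) (bind_pmf \<nu> K) \<le> (\<Sum>y\<in>S. \<Sum>x\<in>S. \<bar>v x\<bar> * R x y)"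
    unfolding l1_dist_def diff
    by (intro sum_mono order.trans[OF sum_abs]) (simp add: abs_mult R)
  also have "\<dots> = (\<Sum>x\<in>S. \<bar>v x\<bar> * (\<Sum>y\<in>S. R x y))"
    by (subst sum.swap) (simp add: sum_distrib_left)
  also have "\<dots> = (1 - \<epsilon>) * l1_dist S \<mu> \<nu>"
    by (simp add: rows l1_dist_def v_def sum_distrib_left mult.commute)
  finally show ?thesis .
qed

text \<open>The state \<open>z\<close> is reached from every state in the same number \<open>m\<close> of steps, so the distance to
  \<open>\<pi>\<close> shrinks by a fixed factor every \<open>m\<close> steps and never grows. Being monotone, it has a limit
  \<open>L\<close>, and then \<open>L \<le> (1 - \<epsilon>) L\<close>.\<close>

lemma law_after_converges:
  assumes S: "finite S" "z \<in> S" "set_pmf \<mu> \<subseteq> S" "set_pmf \<pi> \<subseteq> S"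
    and closed: "\<And>x. x \<in> S \<Longrightarrow> set_pmf (K x) \<subseteq> S"
    and inv: "bind_pmf \<pi> K = \<pi>"
    and hit: "\<And>x. x \<in> S \<Longrightarrow> z \<in> set_pmf (law_after K m (return_pmf x))"
  shows "(\<lambda>n. pmf (law_after K n \<mu>) y) \<longlonglongrightarrow> pmf \<pi> y"
proof -
  define a where "a n = l1_dist S (law_after K n \<mu>) \<pi>" for n
  define \<epsilon> where "\<epsilon> = Min ((\<lambda>x. pmf (law_after K m (return_pmf x)) z) ` S)"
  have \<epsilon>: "0 < \<epsilon>" "\<And>x. x \<in> S \<Longrightarrow> \<epsilon> \<le> pmf (law_after K m (return_pmf x)) z"
  proof -
    have "S \<noteq> {}" using S by auto
    then show "0 < \<epsilon>" using S hit by (simp add: \<epsilon>_def pmf_positive_iff)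
    show "\<epsilon> \<le> pmf (law_after K m (return_pmf x)) z" if "x \<in> S" for x
      using S that by (simp add: \<epsilon>_def)
  qed
  have supp: "set_pmf (law_after K n \<mu>) \<subseteq> S" for n
    using closed S by (intro set_law_after)
  have a0: "0 \<le> a n" for n
    by (simp add: a_def l1_dist_def sum_nonneg)
  have "a (Suc n) \<le> (1 - 0) * a n" for n
    unfolding a_def law_after_Suc using S closed supp
    by (subst inv[symmetric], intro l1_dist_bind_le) auto
  then have "decseq a" by (intro decseq_SucI) simp
  then obtain L where L: "a \<longlonglongrightarrow> L"
    using decseq_convergent[of a 0] a0 by blast
  have "a (m + n) \<le> (1 - \<epsilon>) * a n" for n
  proof -
    have "law_after K (m + n) \<mu> =
        bind_pmf (law_after K n \<mu>) (\<lambda>x. law_after K m (return_pmf x))"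
      by (simp add: law_after_add law_after_as_kernel[of K m "law_after K n \<mu>"])
    moreover have "\<pi> = bind_pmf \<pi> (\<lambda>x. law_after K m (return_pmf x))"
      by (simp add: law_after_as_kernel[symmetric] law_after_invariant inv)
    moreover have "set_pmf (law_after K m (return_pmf x)) \<subseteq> S" if "x \<in> S" for x
      using closed that by (intro set_law_after) auto
    ultimately show ?thesis
      unfolding a_def using S \<epsilon> supp l1_dist_bind_le[of S z "law_after K n \<mu>" \<pi>] by metis
  qed
  then have "L \<le> (1 - \<epsilon>) * L"
    using L LIMSEQ_ignore_initial_segment[OF L, of m]
    by (intro LIMSEQ_le[of "\<lambda>n. a (n + m)" _ "\<lambda>n. (1 - \<epsilon>) * a n"])
       (auto intro!: tendsto_mult_left simp: add.commute)
  then have "\<epsilon> * L \<le> 0" by (simp add: algebra_simps)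
  moreover have "0 \<le> L" using L a0 by (intro LIMSEQ_le_const) auto
  ultimately have "L = 0" using \<epsilon>(1) by (simp add: mult_le_0_iff)
  have bound: "\<bar>pmf (law_after K n \<mu>) y - pmf \<pi> y\<bar> \<le> a n" for n
  proof (cases "y \<in> S")
    case True
    then show ?thesis unfolding a_def l1_dist_def using S(1)
      by (intro member_le_sum[of y S "\<lambda>y. \<bar>pmf (law_after K n \<mu>) y - pmf \<pi> y\<bar>"]) auto
  next
    case False
    then have "y \<notin> set_pmf (law_after K n \<mu>)" "y \<notin> set_pmf \<pi>"
      using supp[of n] S(4) by auto
    then show ?thesis using a0[of n] by (simp add: set_pmf_iff)
  qed
  have "(\<lambda>n. pmf (law_after K n \<mu>) y - pmf \<pi> y) \<longlonglongrightarrow> 0"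
  proof (rule Lim_null_comparison)
    show "\<forall>\<^sub>F n in sequentially. norm (pmf (law_after K n \<mu>) y - pmf \<pi> y) \<le> a n"
      using bound by (intro always_eventually) simp
    show "a \<longlonglongrightarrow> 0" using L \<open>L = 0\<close> by simp
  qed
  then show ?thesis by (rule LIM_zero_cancel)
qed

section \<open>Birth-and-death chains\<close>

locale birth_death =
  fixes N :: nat and K :: "nat \<Rightarrow> nat pmf"
  assumes neighbours: "i \<le> N \<Longrightarrow> set_pmf (K i) \<subseteq> {i - 1..Suc i} \<inter> {..N}"
begin

definition up :: "nat \<Rightarrow> real" where
  "up i = pmf (K i) (Suc i)"

definition down :: "nat \<Rightarrow> real" where
  "down i = (if i = 0 then 0 else pmf (K i) (i - 1))"

lemma up_N [simp]: "up N = 0"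
  using neighbours[of N] by (auto simp: up_def pmf_eq_0_set_pmf)

lemma closed: "x \<in> {..N} \<Longrightarrow> set_pmf (K x) \<subseteq> {..N}"
  using neighbours[of x] by blast

lemma pmf_K:
  assumes "i \<le> N"
  shows "pmf (K i) y = (if y = Suc i then up i else 0) + (if i = Suc y then down i else 0)
    + (if i = y then 1 - up i - down i else 0)"
proof -
  have "(\<Sum>x\<in>{i - 1..Suc i}. pmf (K i) x) = 1"
    using neighbours[OF assms] by (intro sum_pmf_eq_1) auto
  moreover have "{i - 1..Suc i} = (if i = 0 then {i, Suc i} else {i - 1, i, Suc i})"
    by auto
  ultimately have stay: "pmf (K i) i = 1 - up i - down i"
    by (cases i) (simp_all add: up_def down_def)
  have "pmf (K i) y = 0" if "y \<noteq> Suc i" "i \<noteq> Suc y" "i \<noteq> y"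
  proof -
    have "y \<notin> {i - 1..Suc i}" using that by auto
    then show ?thesis using neighbours[OF assms] by (auto simp: pmf_eq_0_set_pmf)
  qed
  then show ?thesis using stay by (auto simp: up_def down_def)
qed

lemma sum_pmf_K:
  assumes "y \<le> N"
  shows "(\<Sum>x\<le>N. p x * pmf (K x) y) =
    (case y of 0 \<Rightarrow> 0 | Suc z \<Rightarrow> p z * up z) + (if y < N then p (Suc y) * down (Suc y) else 0)
    + p y * (1 - up y - down y)"
proof -
  have *: "p x * pmf (K x) y = (if y = Suc x then p x * up x else 0)
      + (if x = Suc y then p x * down x else 0) + (if x = y then p x * (1 - up x - down x) else 0)"
    if "x \<le> N" for x
    using that by (auto simp: pmf_K)
  have "(\<Sum>x\<le>N. p x * pmf (K x) y) = (\<Sum>x\<le>N. if y = Suc x then p x * up x else 0)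
      + (\<Sum>x\<le>N. if x = Suc y then p x * down x else 0)
      + (\<Sum>x\<le>N. if x = y then p x * (1 - up x - down x) else 0)"
    by (simp add: * sum.distrib)
  moreover have "(\<Sum>x\<le>N. if y = Suc x then p x * up x else 0) =
      (case y of 0 \<Rightarrow> 0 | Suc z \<Rightarrow> p z * up z)"
    using assms by (cases y) auto
  ultimately show ?thesis using assms by simp
qed

text \<open>In a stationary regime no net mass crosses the cut between \<open>{..i}\<close> and its complement,
  and the chain crosses it only between \<open>i\<close> and \<open>Suc i\<close>.\<close>

lemma stationary_imp_balance:
  assumes stat: "\<And>y. y \<le> N \<Longrightarrow> p y = (\<Sum>x\<le>N. p x * pmf (K x) y)" and "i < N"
  shows "p i * up i = p (Suc i) * down (Suc i)"
  using \<open>i < N\<close>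
proof (induction i)
  case 0
  have "p 0 = p (Suc 0) * down (Suc 0) + p 0 * (1 - up 0)"
    using stat[of 0] 0 by (simp add: sum_pmf_K down_def)
  then show ?case by (simp add: algebra_simps)
next
  case (Suc i)
  have "p (Suc i) = p i * up i + p (Suc (Suc i)) * down (Suc (Suc i))
      + p (Suc i) * (1 - up (Suc i) - down (Suc i))"
    using stat[of "Suc i"] Suc.prems by (simp add: sum_pmf_K)
  then show ?case using Suc by (simp add: algebra_simps)
qed

lemma balance_imp_stationary:
  assumes "\<And>i. i < N \<Longrightarrow> p i * up i = p (Suc i) * down (Suc i)" and "y \<le> N"
  shows "(\<Sum>x\<le>N. p x * pmf (K x) y) = p y"
proof -
  have "(case y of 0 \<Rightarrow> 0 | Suc z \<Rightarrow> p z * up z) = p y * down y"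
    using assms by (cases y) (auto simp: down_def)
  moreover have "(if y < N then p (Suc y) * down (Suc y) else 0) = p y * up y"
    using assms by (cases "y = N") auto
  ultimately show ?thesis using assms(2) by (simp add: sum_pmf_K algebra_simps)
qed

text \<open>If all downward steps are possible, then 0 is reached from every state in exactly the same
  number of steps as soon as the excursions from 0 can be prolonged by one step, by waiting at a
  state \<open>r\<close> that can be reached from 0.\<close>

lemma law_converges:
  assumes down: "\<And>i. i \<in> {1..N} \<Longrightarrow> 0 < down i"
    and r: "r \<le> N" "\<And>j. j < r \<Longrightarrow> 0 < up j" "up r + down r < 1"
    and inv: "set_pmf \<pi> \<subseteq> {..N}" "bind_pmf \<pi> K = \<pi>" and "set_pmf \<mu> \<subseteq> {..N}"
  shows "(\<lambda>n. pmf (law_after K n \<mu>) y) \<longlonglongrightarrow> pmf \<pi> y"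
proof -
  have descend: "0 \<in> set_pmf (law_after K x (return_pmf x))" if "x \<le> N" for x
    using that
  proof (induction x)
    case (Suc x)
    then have "x \<in> set_pmf (law_after K (Suc 0) (return_pmf (Suc x)))"
      using down[of "Suc x"] by (simp add: law_after_1 down_def pmf_positive_iff)
    from law_after_path[OF this Suc.IH] Suc.prems show ?case by simp
  qed simp
  have ascend: "j \<in> set_pmf (law_after K j (return_pmf 0))" if "j \<le> r" for j
    using that
  proof (induction j)
    case (Suc j)
    then have "Suc j \<in> set_pmf (law_after K (Suc 0) (return_pmf j))"
      using r(2)[of j] by (simp add: law_after_1 up_def pmf_positive_iff)
    from law_after_path[OF _ this] Suc show ?case by simp
  qed simp
  have "0 < pmf (K r) r" using r by (simp add: pmf_K)
  then have wait1: "r \<in> set_pmf (law_after K (Suc 0) (return_pmf r))"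
    by (simp add: law_after_1 pmf_positive_iff)
  have wait: "r \<in> set_pmf (law_after K t (return_pmf r))" for t
  proof (induction t)
    case (Suc t)
    from law_after_path[OF this wait1] show ?case by simp
  qed simp
  have "0 \<in> set_pmf (law_after K (N + 2 * r) (return_pmf x))" if "x \<le> N" for x
  proof -
    have "0 \<in> set_pmf (law_after K (r + ((N - x) + (r + x))) (return_pmf x))"
      using descend[OF that] ascend[of r] wait[of "N - x"] descend[OF r(1)]
      by (auto intro: law_after_path)
    also have "r + ((N - x) + (r + x)) = N + 2 * r" using that by simp
    finally show ?thesis .
  qed
  then show ?thesis
    using closed inv \<open>set_pmf \<mu> \<subseteq> {..N}\<close>
    by (intro law_after_converges[where S = "{..N}" and z = 0 and m = "N + 2 * r"]) auto
qed

text \<open>A vanishing weight at 0 would propagate upwards to all states.\<close>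

lemma balance_0_nonzero:
  assumes down: "\<And>i. i \<in> {1..N} \<Longrightarrow> 0 < down i"
    and p: "\<And>i. i < N \<Longrightarrow> p i * up i = p (Suc i) * down (Suc i)" "(\<Sum>i\<le>N. p i) = 1"
  shows "p 0 \<noteq> 0"
proof
  assume "p 0 = 0"
  have "p j = 0" if "j \<le> N" for j
    using that
  proof (induction j)
    case (Suc j)
    then show ?case using p(1)[of j] down[of "Suc j"] by simp
  qed (rule \<open>p 0 = 0\<close>)
  then show False using p(2) by simp
qed

lemma balance_pos:
  assumes down: "\<And>i. i \<in> {1..N} \<Longrightarrow> 0 < down i" and up: "\<And>i. i < N \<Longrightarrow> 0 < up i"
    and p: "\<And>i. i < N \<Longrightarrow> p i * up i = p (Suc i) * down (Suc i)" "(\<Sum>i\<le>N. p i) = 1"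
    and "0 \<le> p 0" "i \<le> N"
  shows "0 < p i"
  using \<open>i \<le> N\<close>
proof (induction i)
  case 0
  then show ?case using balance_0_nonzero[of p] down p \<open>0 \<le> p 0\<close> by force
next
  case (Suc i)
  then have "0 < p i * up i" using up[of i] by simp
  then have "0 < p (Suc i) * down (Suc i)" using p(1)[of i] Suc.prems by simp
  then show ?case using down[of "Suc i"] Suc.prems by (simp add: zero_less_mult_iff)
qed

text \<open>The ratios of consecutive weights are prescribed, so two balanced laws are proportional.\<close>

lemma balance_unique:
  assumes down: "\<And>i. i \<in> {1..N} \<Longrightarrow> 0 < down i"
    and p: "\<And>i. i < N \<Longrightarrow> p i * up i = p (Suc i) * down (Suc i)" "(\<Sum>i\<le>N. p i) = 1"
    and p': "\<And>i. i < N \<Longrightarrow> p' i * up i = p' (Suc i) * down (Suc i)" "(\<Sum>i\<le>N. p' i) = 1"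
    and "i \<le> N"
  shows "p i = p' i"
proof -
  have proportional: "p i * p' 0 = p' i * p 0" if "i \<le> N" for i
    using that
  proof (induction i)
    case (Suc i)
    have "p (Suc i) * p' 0 * down (Suc i) = p' (Suc i) * p 0 * down (Suc i)"
    proof -
      have "p (Suc i) * p' 0 * down (Suc i) = p i * up i * p' 0"
        using Suc.prems p(1)[of i] by simp
      also have "\<dots> = p i * p' 0 * up i" by simp
      also have "\<dots> = p' i * p 0 * up i" using Suc by simp
      also have "\<dots> = p' i * up i * p 0" by simp
      also have "\<dots> = p' (Suc i) * p 0 * down (Suc i)"
        using Suc.prems p'(1)[of i] by simp
      finally show ?thesis .
    qed
    then show ?case using down[of "Suc i"] Suc.prems by simp
  qed simp
  have "(\<Sum>i\<le>N. p i * p' 0) = (\<Sum>i\<le>N. p' i * p 0)"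
    by (intro sum.cong) (auto simp: proportional)
  then have eq0: "p 0 = p' 0"
    by (simp add: sum_distrib_right[symmetric] p(2) p'(2))
  have "p' 0 \<noteq> 0" using down p' by (rule balance_0_nonzero)
  then show ?thesis using proportional[OF \<open>i \<le> N\<close>] eq0 by simp
qed

end

section \<open>The flip probabilities\<close>

lemma thr_reflect:
  assumes "l \<le> N" "0 < N"
  shows "thr N \<alpha> (N - l) = thr N \<alpha> l"
proof -
  have "real (N - l) / real N - 1/2 = - (real l / real N - 1/2)"
    using assms by (simp add: of_nat_diff field_simps)
  then show ?thesis by (simp only: thr_def abs_minus_cancel)
qed

lemma window_reflect: "l \<le> N \<Longrightarrow> real (N - l) \<in> window N d \<alpha> \<longleftrightarrow> real l \<in> window N d \<alpha>"
  by (auto simp: window_def of_nat_diff right_diff_distrib distrib_left)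

text \<open>Both sums count samples of \<open>2 d\<close> among \<open>N - 1\<close> sites. Exchanging the signs of all spins turns
  \<open>j\<close> positive sampled sites into \<open>2 d - j\<close> and \<open>i\<close> positive sites into \<open>N - i\<close>.\<close>

lemma Pbar_pp_reflect:
  assumes "l \<le> N" "0 < N" "0 < \<alpha>"
  shows "Pbar_pp N d \<alpha> (N - l) = Pbar_mm N d \<alpha> l"
proof -
  have "(\<Sum>j \<in> {j::nat. max (int d + thr N \<alpha> l) (int (N - l) + 2 * int d - int N) \<le> int j \<and>
                       int j \<le> min (2 * int d) (int (N - l))}.
          real ((N - l - 1) choose j) * real ((N - (N - l)) choose (2 * d - j)))
      = (\<Sum>j \<in> {j::nat. max 0 (int l + 2 * int d - int N) \<le> int j \<and>
                       int j \<le> min (int d - thr N \<alpha> l) (int l)}.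
          real (l choose j) * real ((N - l - 1) choose (2 * d - j)))"
    using thr_nonneg[OF \<open>0 < \<alpha>\<close>, of N l] assms
    by (intro sum.reindex_bij_witness[of _ "\<lambda>j. 2 * d - j" "\<lambda>j. 2 * d - j"])
       (auto simp: of_nat_diff mult.commute)
  then show ?thesis
    by (simp only: Pbar_pp_def Pbar_mm_def thr_reflect[OF assms(1,2)] window_reflect[OF assms(1)])
qed

text \<open>For \<open>\<alpha> > 2 d\<close> a sample that contains as many positive sites as possible always violates the
  threshold, hence its term is missing from the full Vandermonde sum. For \<open>l > d\<close> it has
  more than \<open>d\<close> positive sites. For \<open>0 < l \<le> d\<close> it has \<open>l\<close> of them, and
  \<open>c > 2 d (1/2 - l / N) = d - l (2 d / N) > d - l\<close>. The remaining label
  \<open>l = 0\<close> lies outside the window.\<close>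

lemma Pbar_mm_less_1:
  assumes "1 \<le> d" "2 * d + 1 \<le> N" "2 * real d < \<alpha>" "l < N"
  shows "Pbar_mm N d \<alpha> l < 1"
proof (cases "real l \<in> window N d \<alpha>")
  case True
  let ?J = "{j::nat. max 0 (int l + 2 * int d - int N) \<le> int j \<and>
                     int j \<le> min (int d - thr N \<alpha> l) (int l)}"
  let ?f = "\<lambda>j. real (l choose j) * real ((N - l - 1) choose (2 * d - j))"
  \<comment> \<open>the largest possible number of positive sites in the sample\<close>
  define j0 where "j0 = min (2 * d) l"
  have thr0: "0 \<le> thr N \<alpha> l" using assms by (intro thr_nonneg) auto
  have "0 < real N * (1/2 - real d / \<alpha>)"
    using assms by (intro mult_pos_pos) (auto simp: field_simps)
  then have "0 < l" using True by (auto simp: window_def intro: Nat.gr0I)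
  have "int d - int l < thr N \<alpha> l"
  proof (cases "l \<le> d")
    case True
    have "real l * (2 * real d / real N) < real l * 1"
      using \<open>0 < l\<close> assms by (intro mult_strict_left_mono) auto
    then have "real d - real l < 2 * real d * (1/2 - real l / real N)"
      by (simp add: algebra_simps)
    also have "\<dots> \<le> \<alpha> * \<bar>real l / real N - 1/2\<bar>"
      using assms True by (intro mult_mono) (auto simp: field_simps)
    also have "\<dots> \<le> of_int (thr N \<alpha> l)"
      unfolding thr_def by (rule le_of_int_ceiling)
    finally show ?thesis by linarith
  qed (use thr0 in simp)
  then have "j0 \<notin> ?J" using thr0 assms by (auto simp: j0_def)
  have "?J \<subseteq> {..2 * d} - {j0}" using thr0 \<open>j0 \<notin> ?J\<close> by auto
  then have "sum ?f ?J \<le> sum ?f ({..2 * d} - {j0})" by (intro sum_mono2) auto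
  also have "\<dots> < sum ?f {..2 * d}"
  proof -
    have "0 < ?f j0" using assms by (auto simp: j0_def min_def)
    then show ?thesis by (subst sum.remove[of "{..2 * d}" j0]) (auto simp: j0_def)
  qed
  also have "\<dots> = real (\<Sum>j\<le>2 * d. (l choose j) * ((N - l - 1) choose (2 * d - j)))" by simp
  also have "\<dots> = real ((l + (N - l - 1)) choose (2 * d))" by (simp only: vandermonde)
  also have "l + (N - l - 1) = N - 1" using assms by simp
  finally show ?thesis
    using True assms by (simp add: Pbar_mm_def)
qed (simp add: Pbar_mm_def)

section \<open>The chain of the first spins for constant second spins\<close>

text \<open>While the second spins are constant, \<open>N\<^sup>+\<close> is a birth-and-death chain of its own. The
  convention \<open>s 0 = 1\<close> for the state 0 makes the numerator of \<open>g\<close> at 0 agree with the upward rate.\<close>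

locale frozen_chain =
  fixes N d :: nat and \<alpha> q :: real and s :: "nat \<Rightarrow> int"
  assumes d: "1 \<le> d" and N: "2 * d + 1 \<le> N" and \<alpha>: "0 < \<alpha>" and q: "0 < q" "q \<le> 1"
    and s: "s i \<in> {-1, 1}" and s0: "s 0 = 1"
begin

abbreviation K :: "nat \<Rightarrow> nat pmf" where
  "K i \<equiv> Nplus_step N d \<alpha> q i (s i)"

definition Sm :: "nat set" where "Sm = {i \<in> {1..N}. s i = -1}"
definition Sp :: "nat set" where "Sp = {i \<in> {1..N}. s i = 1}"

text \<open>Up to the sampling factors \<open>1 - i / N\<close> and \<open>i / N\<close>, \<open>num\<close> and \<open>den\<close> are the upward and
  downward rates; their quotients are the factors of \<open>g\<close>.\<close>

definition num :: "nat \<Rightarrow> real" where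
  "num i = 1 - q * Pbar_mm N d \<alpha> i - (1 - q) * indicator Sm i"

definition den :: "nat \<Rightarrow> real" where
  "den i = 1 - q * Pbar_pp N d \<alpha> i - (1 - q) * indicator Sp i"

sublocale birth_death N K
proof
  fix i assume "i \<le> N"
  show "set_pmf (K i) \<subseteq> {i - 1..Suc i} \<inter> {..N}"
  proof (cases "i = N")
    case True
    have "False \<notin> set_pmf (bernoulli_pmf 1)" by (simp add: set_pmf_iff)
    then show ?thesis using True N by (auto simp: Nplus_step_def split: if_splits)
  next
    case False
    then show ?thesis
      using set_pmf_Nplus_step[of N d \<alpha> q i "s i"] \<open>i \<le> N\<close> by fastforce
  qed
qed

lemma Npos: "0 < real N"
  using N by simp

lemma num_eq: "i < N \<Longrightarrow> num i = q * (1 - Pbar_mm N d \<alpha> i) + (1 - q) * ((1 + of_int (s i)) / 2)"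
  using s[of i] s0 by (cases "i = 0") (auto simp: num_def Sm_def field_simps)

lemma den_eq:
  "i \<in> {1..N} \<Longrightarrow> den i = q * (1 - Pbar_pp N d \<alpha> i) + (1 - q) * ((1 - of_int (s i)) / 2)"
  using s[of i] by (auto simp: den_def Sp_def field_simps)

lemma num_unit: "i < N \<Longrightarrow> num i \<in> {0..1}"
  using s[of i] q Pbar_mm_unit[of i N \<alpha> d] \<alpha> unfolding num_eq
  by (intro unit_mix) auto

lemma den_unit: "i \<in> {1..N} \<Longrightarrow> den i \<in> {0..1}"
  using s[of i] q Pbar_pp_unit[of i N d \<alpha>] unfolding den_eq
  by (intro unit_mix) auto

lemma up_eq: "i \<le> N \<Longrightarrow> up i = (1 - real i / real N) * num i"
  using pmf_Nplus_step_up[of \<alpha> q i N "s i" d] s[of i] \<alpha> q Npos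
  by (cases "i = N") (simp_all add: up_def[of i] num_eq)

lemma down_eq: "i \<in> {1..N} \<Longrightarrow> down i = real i / real N * den i"
  using pmf_Nplus_step_down[of q i N "s i" d \<alpha>] s[of i] q
  by (simp add: down_def den_eq)

lemma up_le: "i \<le> N \<Longrightarrow> up i \<le> 1 - real i / real N"
  using num_unit[of i] Npos by (cases "i = N") (auto simp: up_eq intro!: mult_left_le)

lemma down_le: "i \<le> N \<Longrightarrow> down i \<le> real i / real N"
  using den_unit[of i] mult_left_mono[of "den i" 1 "real i / real N"]
  by (cases "i = 0") (auto simp: down_eq down_def[of 0])

lemma up_pos: "i < N \<Longrightarrow> Pbar_mm N d \<alpha> i < 1 \<Longrightarrow> 0 < up i"
  using q s[of i] by (auto simp: up_eq num_eq intro!: mult_pos_pos add_pos_nonneg)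

lemma down_pos: "i \<in> {1..N} \<Longrightarrow> Pbar_pp N d \<alpha> i < 1 \<Longrightarrow> 0 < down i"
  unfolding down_eq den_eq using q s[of i] Npos
  by (intro mult_pos_pos add_pos_nonneg) auto

lemma down_pos_iff: "i \<in> {1..N} \<Longrightarrow> 0 < down i \<longleftrightarrow> den i \<noteq> 0"
  using den_unit[of i] Npos by (auto simp: down_eq zero_less_mult_iff)

lemma g_defined_iff_den: "g_defined N d \<alpha> q Sp \<longleftrightarrow> (\<forall>i\<in>{1..N}. den i \<noteq> 0)"
  by (simp add: g_defined_def den_def)

lemma g_defined_iff_down: "g_defined N d \<alpha> q Sp \<longleftrightarrow> (\<forall>i\<in>{1..N}. 0 < down i)"
  by (simp add: g_defined_iff_den down_pos_iff)

abbreviation g :: "nat \<Rightarrow> real" where "g \<equiv> g_weight N d \<alpha> q Sm Sp"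
abbreviation p_inf :: "nat \<Rightarrow> real" where "p_inf \<equiv> pi_inf N d \<alpha> q Sm Sp"

lemma g_0: "g 0 = 1"
  by (simp add: g_weight_def)

lemma g_nonneg: "i \<le> N \<Longrightarrow> 0 \<le> g i"
  using num_unit den_unit
  by (auto simp: g_weight_def num_def[symmetric] den_def[symmetric]
      intro!: mult_nonneg_nonneg prod_nonneg divide_nonneg_nonneg)

text \<open>Absorption of binomial coefficients, \<open>(i + 1) (N choose i + 1) = (N - i) (N choose i)\<close>, matches the
  factors \<open>i / N\<close> and \<open>1 - i / N\<close> of the rates.\<close>

lemma g_balance:
  assumes "g_defined N d \<alpha> q Sp" "i < N"
  shows "g i * up i = g (Suc i) * down (Suc i)"
proof -
  define P where "P = (\<Prod>j<i. num j / den (j + 1))"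
  have g_i: "g i = real (N choose i) * P"
    and g_Suc: "g (Suc i) = real (N choose Suc i) * (P * (num i / den (Suc i)))"
    by (simp_all add: g_weight_def P_def num_def den_def)
  have "Suc i * (N choose Suc i) = (N - i) * (N choose i)"
    by (simp only: binomial_absorb_comp binomial_absorption)
  then have "real (Suc i) * real (N choose Suc i) = real (N - i) * real (N choose i)"
    by (simp only: of_nat_mult[symmetric])
  then have binom: "real (Suc i) * real (N choose Suc i) = (real N - real i) * real (N choose i)"
    using assms(2) by (simp only: of_nat_diff less_imp_le)
  have "den (Suc i) \<noteq> 0" using assms by (simp add: g_defined_iff_den)
  then have "g (Suc i) * down (Suc i) = (real (Suc i) * real (N choose Suc i)) * (P * num i / real N)"
    using assms(2) by (simp add: g_Suc down_eq del: of_nat_Suc)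
  also have "\<dots> = g i * ((real N - real i) / real N * num i)"
    by (simp add: binom g_i del: of_nat_Suc)
  also have "(real N - real i) / real N = 1 - real i / real N"
    using Npos by (simp add: diff_divide_distrib)
  also have "\<dots> * num i = up i"
    using assms(2) by (simp add: up_eq)
  finally show ?thesis by simp
qed

lemma g_sum: "(\<Sum>i\<le>N. g i) = 1 + Z_sum N d \<alpha> q Sm Sp"
  by (simp add: Z_sum_def sum.atLeast1_atMost_eq sum.atMost_shift g_0 lessThan_Suc_atMost)

lemma normaliser_pos: "0 < 1 + Z_sum N d \<alpha> q Sm Sp"
proof -
  have "0 \<le> Z_sum N d \<alpha> q Sm Sp" unfolding Z_sum_def by (intro sum_nonneg g_nonneg) auto
  then show ?thesis by simp
qed

lemma p_inf_nonneg: "0 \<le> p_inf i"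
  using normaliser_pos g_nonneg by (auto simp: pi_inf_def intro!: divide_nonneg_pos)

lemma p_inf_0: "0 < p_inf 0"
  using normaliser_pos by (simp add: pi_inf_def g_0)

lemma p_inf_sum: "(\<Sum>i\<le>N. p_inf i) = 1"
  using normaliser_pos by (simp add: pi_inf_def sum_divide_distrib[symmetric] g_sum)

lemma p_inf_balance:
  "g_defined N d \<alpha> q Sp \<Longrightarrow> i < N \<Longrightarrow> p_inf i * up i = p_inf (Suc i) * down (Suc i)"
  using g_balance[of i] by (simp add: pi_inf_def)

definition inv_law :: "nat pmf" where
  "inv_law = embed_pmf p_inf"

lemma pmf_inv_law: "pmf inv_law = p_inf"
proof -
  have "(\<integral>\<^sup>+ x. ennreal (p_inf x) \<partial>count_space UNIV)
      = (\<integral>\<^sup>+ x. ennreal (p_inf x) * indicator {..N} x \<partial>count_space UNIV)"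
    by (intro nn_integral_cong) (auto simp: pi_inf_def indicator_def)
  also have "\<dots> = (\<integral>\<^sup>+ x. ennreal (p_inf x) \<partial>count_space {..N})"
    by (simp add: nn_integral_count_space_indicator)
  also have "\<dots> = ennreal (\<Sum>i\<le>N. p_inf i)"
    by (simp add: nn_integral_count_space_finite p_inf_nonneg)
  finally show ?thesis
    unfolding inv_law_def by (intro ext pmf_embed_pmf) (simp_all add: p_inf_nonneg p_inf_sum)
qed

lemma set_inv_law: "set_pmf inv_law \<subseteq> {..N}"
  by (auto simp: set_pmf_iff pmf_inv_law pi_inf_def split: if_splits)

lemma inv_law_invariant:
  assumes "g_defined N d \<alpha> q Sp"
  shows "bind_pmf inv_law K = inv_law"
proof (rule pmf_eqI)
  fix y
  show "pmf (bind_pmf inv_law K) y = pmf inv_law y"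
  proof (cases "y \<le> N")
    case True
    then show ?thesis
      using assms set_inv_law
      by (simp add: pmf_bind_finite[of "{..N}"] pmf_inv_law balance_imp_stationary p_inf_balance)
  next
    case False
    then have "y \<notin> set_pmf (bind_pmf inv_law K)" "y \<notin> set_pmf inv_law"
      using set_inv_law closed by auto
    then show ?thesis by (metis pmf_eq_0_set_pmf)
  qed
qed

lemma stationary_law_unique:
  assumes "g_defined N d \<alpha> q Sp" "set_pmf \<nu> \<subseteq> {..N}" "bind_pmf \<nu> K = \<nu>"
  shows "\<nu> = inv_law"
proof (rule pmf_eqI)
  fix y
  have stat: "pmf \<nu> y = (\<Sum>x\<le>N. pmf \<nu> x * pmf (K x) y)" for y
    using assms pmf_bind_finite[of "{..N}" \<nu> K y] by simp
  have bal: "pmf \<nu> i * up i = pmf \<nu> (Suc i) * down (Suc i)" if "i < N" for i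
    by (rule stationary_imp_balance[OF stat that])
  show "pmf \<nu> y = pmf inv_law y"
  proof (cases "y \<le> N")
    case True
    have "(\<Sum>i\<le>N. pmf \<nu> i) = 1" using assms by (intro sum_pmf_eq_1) auto
    then show ?thesis
      using assms(1) bal p_inf_balance[OF assms(1)] p_inf_sum True
      unfolding pmf_inv_law g_defined_iff_down by (intro balance_unique[of "pmf \<nu>" p_inf]) auto
  next
    case False
    then have "y \<notin> set_pmf \<nu>" "y \<notin> set_pmf inv_law"
      using set_inv_law assms by auto
    then show ?thesis by (simp add: set_pmf_iff)
  qed
qed

text \<open>If an upward step below \<open>N\<close> is impossible, the chain waits at the first such state whenever a
  site with negative first spin is chosen. Otherwise 0 leads to every state; for \<open>q < 1\<close> the second
  spin at 1 vetoes a flip in one of the two directions with positive probability, and for \<open>q = 1\<close> a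
  nonzero \<open>Pbar_pp\<close> is a probability of waiting.\<close>

lemma waiting_state:
  assumes "not_alternating N d \<alpha> q"
  obtains r where "r \<le> N" "\<And>j. j < r \<Longrightarrow> 0 < up j" "up r + down r < 1"
proof (cases "\<exists>m<N. \<not> 0 < up m")
  case True
  define r where "r = (LEAST m. m < N \<and> \<not> 0 < up m)"
  have r: "r < N" "\<not> 0 < up r"
    using LeastI_ex[OF True] by (auto simp: r_def)
  have "0 < up j" if "j < r" for j
    using not_less_Least[of j "\<lambda>m. m < N \<and> \<not> 0 < up m"] that r by (auto simp: r_def)
  moreover have "down r < 1"
  proof -
    have "down r \<le> real r / real N" using r by (intro down_le) simp
    also have "\<dots> < 1" using r Npos by simp
    finally show ?thesis .
  qed
  ultimately show ?thesis using that[of r] r by auto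
next
  case False
  have "\<exists>r\<le>N. up r + down r < 1"
  proof (cases "q < 1")
    case True
    have one: "1 < N" using N d by simp
    have "up 1 \<le> (1 - 1 / real N) * (if s 1 = -1 then q else 1)"
      using one q Pbar_mm_unit[of 1 N \<alpha> d] \<alpha> num_unit[of 1]
      by (auto simp: up_eq num_eq intro!: mult_left_mono mult_left_le)
    moreover have "down 1 \<le> 1 / real N * (if s 1 = 1 then q else 1)"
      using one q Pbar_pp_unit[of 1 N d \<alpha>] den_unit[of 1]
      by (auto simp: down_eq den_eq intro!: divide_right_mono mult_left_le)
    moreover have "(1 - 1 / real N) * q < 1 - 1 / real N" "1 / real N * q < 1 / real N"
      using True one mult_strict_left_mono[of q 1 "1 - 1 / real N"]
        mult_strict_left_mono[of q 1 "1 / real N"] by auto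
    ultimately have "up 1 + down 1 < 1"
      using s[of 1] by (auto split: if_splits)
    then show ?thesis using one by (intro exI[of _ 1]) auto
  next
    case False
    then have "q = 1" using q by simp
    then obtain i where i: "i \<in> {1..N}" "Pbar_pp N d \<alpha> i \<noteq> 0"
      using assms by (auto simp: not_alternating_def)
    then have "den i < 1"
      using Pbar_pp_unit[of i N d \<alpha>] \<open>q = 1\<close> unfolding den_def by simp
    then have "real i / real N * den i < real i / real N * 1"
      using i Npos by (intro mult_strict_left_mono) auto
    then have "up i + down i < 1" using up_le[of i] i by (simp add: down_eq)
    then show ?thesis using i by auto
  qed
  then show ?thesis using that False by (meson order_less_le_trans)
qed

lemma law_after_tendsto_p_inf:
  assumes "g_defined N d \<alpha> q Sp" "not_alternating N d \<alpha> q" "k \<le> N"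
  shows "(\<lambda>n. pmf (law_after K n (return_pmf k)) y) \<longlonglongrightarrow> p_inf y"
proof -
  obtain r where "r \<le> N" "\<And>j. j < r \<Longrightarrow> 0 < up j" "up r + down r < 1"
    using waiting_state[OF assms(2)] by blast
  then have "(\<lambda>n. pmf (law_after K n (return_pmf k)) y) \<longlonglongrightarrow> pmf inv_law y"
    using assms set_inv_law inv_law_invariant
    by (intro law_converges) (auto simp: g_defined_iff_down)
  then show ?thesis by (simp add: pmf_inv_law)
qed

end

text \<open>The upward rate at \<open>i\<close> depends only on the second spin at \<open>i\<close>, and the downward rate at
  \<open>Suc i\<close> determines the second spin there if \<open>q < 1\<close>. So one balanced law fixes all second spins
  successively, starting from the conventional spin at 0.\<close>

lemma balance_determines_spins:
  assumes A: "frozen_chain N d \<alpha> q s" and B: "frozen_chain N d \<alpha> q s'" and "q < 1"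
    and pos: "\<And>i. i \<in> {1..N} \<Longrightarrow> 0 < p i"
    and bal: "\<And>i. i < N \<Longrightarrow> p i * birth_death.up (\<lambda>i. Nplus_step N d \<alpha> q i (s i)) i
        = p (Suc i) * birth_death.down (\<lambda>i. Nplus_step N d \<alpha> q i (s i)) (Suc i)"
    and bal': "\<And>i. i < N \<Longrightarrow> p i * birth_death.up (\<lambda>i. Nplus_step N d \<alpha> q i (s' i)) i
        = p (Suc i) * birth_death.down (\<lambda>i. Nplus_step N d \<alpha> q i (s' i)) (Suc i)"
    and "i \<le> N"
  shows "s i = s' i"
proof -
  interpret A: frozen_chain N d \<alpha> q s by fact
  interpret B: frozen_chain N d \<alpha> q s' by fact
  show ?thesis using \<open>i \<le> N\<close>
  proof (induction i)
    case 0
    show ?case by (simp add: A.s0 B.s0)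
  next
    case (Suc i)
    then have "A.up i = B.up i" by (simp add: A.up_def B.up_def)
    then have "p (Suc i) * A.down (Suc i) = p (Suc i) * B.down (Suc i)"
      using bal[of i] bal'[of i] Suc.prems by (metis Suc_le_lessD)
    then have "A.den (Suc i) = B.den (Suc i)"
      using pos[of "Suc i"] Suc.prems A.Npos by (simp add: A.down_eq B.down_eq)
    then show ?case
      using Suc.prems \<open>q < 1\<close> by (simp add: A.den_eq B.den_eq)
  qed
qed

section \<open>The second spins\<close>

text \<open>The second spin used by the first spin when \<open>N\<^sup>+ = i\<close>.\<close>

definition label_spin :: "('y \<Rightarrow> nat) \<Rightarrow> ('y \<Rightarrow> int) \<Rightarrow> nat \<Rightarrow> int" where
  "label_spin \<phi> \<eta> i = (if i = 0 then 1 else \<eta> (inv \<phi> i))"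

locale frozen_process =
  fixes N d :: nat and \<alpha> \<gamma> q :: real and \<phi> :: "'y::finite \<Rightarrow> nat"
  assumes d: "1 \<le> d" and N: "2 * d + 1 \<le> N" and \<alpha>: "0 < \<alpha>" and q: "0 < q" "q \<le> 1"
    and \<phi>: "bij_betw \<phi> UNIV {1..N}"
begin

abbreviation "A\<^sub>1 \<equiv> A1 N d \<alpha> \<gamma> q"
abbreviation "A\<^sub>2 \<equiv> A2 N d \<alpha> \<gamma> q"
abbreviation "A\<^sub>3 \<equiv> A3 N d \<alpha> \<gamma> q"
abbreviation "A\<^sub>4 \<equiv> A4 N d \<alpha> \<gamma> q"
abbreviation "step \<equiv> eta2_step N d \<alpha> \<gamma> q \<phi>"
abbreviation "eta \<equiv> eta2_at N d \<alpha> \<gamma> q \<phi>"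
abbreviation "rest \<equiv> settled N d \<alpha> \<gamma> q \<phi>"
abbreviation "law \<equiv> frozen_law N d \<alpha> \<gamma> q \<phi>"
abbreviation "Sminus \<eta> \<equiv> S_minus N d \<alpha> \<gamma> q (\<lambda>i. \<eta> (inv \<phi> i))"
abbreviation "Splus \<eta> \<equiv> S_plus N d \<alpha> \<gamma> q (\<lambda>i. \<eta> (inv \<phi> i))"
abbreviation "K \<eta> \<equiv> (\<lambda>i. Nplus_step N d \<alpha> q i (label_spin \<phi> \<eta> i))"
abbreviation "weights \<eta> \<equiv> pi_inf N d \<alpha> q (Sminus \<eta>) (Splus \<eta>)"

lemma \<phi>_inv: "i \<in> {1..N} \<Longrightarrow> \<phi> (inv \<phi> i) = i"
  using \<phi> by (simp add: bij_betw_def f_inv_into_f)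

lemma inv_\<phi>: "inv \<phi> (\<phi> x) = x"
  using \<phi> by (simp add: bij_betw_def)

lemma \<phi>_range: "\<phi> x \<in> {1..N}"
  using \<phi> by (auto simp: bij_betw_def)

lemma labels_cases:
  obtains "\<phi> x \<in> A\<^sub>1" | "\<phi> x \<in> A\<^sub>2" | "\<phi> x \<in> A\<^sub>3" | "\<phi> x \<in> A\<^sub>4"
  using \<phi>_range[of x] by (auto simp: A1_def A2_def A3_def A4_def)

lemma spin_cases: "\<eta> \<in> spin_configs \<Longrightarrow> \<eta> x = 1 \<or> \<eta> x = -1"
  by (auto simp: spin_configs_def)

lemma step_spin_configs: "step \<eta> \<in> spin_configs"
  by (simp add: spin_configs_def eta2_step_def)

lemma eta_0 [simp]: "eta \<eta> 0 = \<eta>"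
  by (simp add: eta2_at_def)

lemma eta_Suc: "eta \<eta> (Suc n) = step (eta \<eta> n)"
  by (simp add: eta2_at_def)

lemma eta_spin_configs: "\<eta> \<in> spin_configs \<Longrightarrow> eta \<eta> n \<in> spin_configs"
  by (cases n) (simp_all add: eta_Suc step_spin_configs)

lemma rest_spin_configs: "\<eta> \<in> spin_configs \<Longrightarrow> rest \<eta> \<in> spin_configs"
  by (simp add: spin_configs_def settled_def)

lemma rest_A2: "\<phi> x \<in> A\<^sub>2 \<Longrightarrow> rest \<eta> x = \<eta> x"
  by (auto simp: settled_def A1_def A2_def A4_def)

lemma step_eq_rest:
  assumes "A\<^sub>3 = {}" "\<eta> \<in> spin_configs"
  shows "step \<eta> = rest \<eta>"
proof
  fix x
  have "\<phi> x \<notin> A\<^sub>3" using assms by simp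
  then show "step \<eta> x = rest \<eta> x"
    using \<phi>_range[of x] spin_cases[OF assms(2), of x]
    by (auto simp: eta2_step_def settled_def A1_def A3_def A4_def)
qed

lemma step_rest:
  assumes "A\<^sub>3 = {}" "\<eta> \<in> spin_configs"
  shows "step (rest \<eta>) = rest \<eta>"
  using step_eq_rest[OF assms(1) rest_spin_configs[OF assms(2)]]
  by (simp add: settled_def fun_eq_iff)

lemma eta_settles:
  assumes "A\<^sub>3 = {}" "\<eta> \<in> spin_configs"
  shows "eta \<eta> (Suc n) = rest \<eta>"
  using assms by (induction n) (simp_all add: eta_Suc step_eq_rest step_rest)

text \<open>A label of \<open>A\<^sub>3\<close> keeps neither of the two spins.\<close>

lemma step_A3: "\<eta> \<in> spin_configs \<Longrightarrow> \<phi> x \<in> A\<^sub>3 \<Longrightarrow> step \<eta> x = - \<eta> x"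
  using spin_cases[of \<eta> x] by (auto simp: eta2_step_def A3_def)

text \<open>After one update, a second spin is constant or oscillates with period 2.\<close>

lemma step_step_step: "\<eta> \<in> spin_configs \<Longrightarrow> step (step (step \<eta>)) = step \<eta>"
  using spin_cases[of \<eta>] by (auto simp: eta2_step_def fun_eq_iff)

lemma eta_even: "\<eta> \<in> spin_configs \<Longrightarrow> eta \<eta> (2 * m + 2) = eta \<eta> 2"
proof (induction m)
  case (Suc m)
  have "eta \<eta> (2 * Suc m + 2) = step (step (step (eta \<eta> (Suc (2 * m)))))"
    by (simp add: eta_Suc)
  also have "\<dots> = eta \<eta> (2 * m + 2)"
    using Suc.prems by (simp add: step_step_step eta_spin_configs eta_Suc)
  finally show ?case using Suc by simp
qed (simp add: numeral_2_eq_2)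

lemma eta_odd: "\<eta> \<in> spin_configs \<Longrightarrow> eta \<eta> (2 * m + 1) = eta \<eta> 1"
proof (induction m)
  case (Suc m)
  have "eta \<eta> (2 * Suc m + 1) = step (step (step (eta \<eta> (2 * m))))"
    by (simp add: eta_Suc)
  also have "\<dots> = eta \<eta> (2 * m + 1)"
    using Suc.prems by (simp add: step_step_step eta_spin_configs eta_Suc)
  finally show ?case using Suc by simp
qed simp

section \<open>Reduction to the first spins\<close>

lemma frozen_step_eq:
  "frozen_step N d \<alpha> \<gamma> q \<phi> (i, \<eta>) = map_pmf (\<lambda>j. (j, step \<eta>)) (K (step \<eta>) i)"
  by (simp add: frozen_step_def Let_def label_spin_def)

lemma chain: "\<eta> \<in> spin_configs \<Longrightarrow> frozen_chain N d \<alpha> q (label_spin \<phi> \<eta>)"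
  using d N \<alpha> q by unfold_locales (auto simp: label_spin_def spin_configs_def)

lemma law_Suc:
  assumes "law k \<eta> n = map_pmf (\<lambda>i. (i, \<zeta>)) \<mu>"
  shows "law k \<eta> (Suc n) = map_pmf (\<lambda>i. (i, step \<zeta>)) (bind_pmf \<mu> (K (step \<zeta>)))"
  by (simp add: assms bind_map_pmf frozen_step_eq map_bind_pmf)

text \<open>The second spins evolve deterministically, so the joint law is carried by a single configuration.\<close>

lemma law_product:
  "law k \<eta> n = map_pmf (\<lambda>i. (i, eta \<eta> n)) (map_pmf fst (law k \<eta> n))"
proof -
  have "\<exists>\<mu>. law k \<eta> n = map_pmf (\<lambda>i. (i, eta \<eta> n)) \<mu>"
  proof (induction n)
    case 0
    show ?case by (intro exI[of _ "return_pmf k"]) simp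
  next
    case (Suc n)
    then show ?case using law_Suc[of k \<eta> n] by (auto simp: eta_Suc simp del: frozen_law.simps)
  qed
  then show ?thesis by (auto simp: pmf.map_comp o_def)
qed

lemma fst_law_Suc:
  "map_pmf fst (law k \<eta> (Suc n)) = bind_pmf (map_pmf fst (law k \<eta> n)) (K (eta \<eta> (Suc n)))"
  unfolding law_Suc[OF law_product] by (simp add: pmf.map_comp o_def eta_Suc)

lemma set_fst_law:
  assumes "k \<le> N" "\<eta> \<in> spin_configs"
  shows "set_pmf (map_pmf fst (law k \<eta> n)) \<subseteq> {..N}"
proof (induction n)
  case 0
  show ?case using assms by simp
next
  case (Suc n)
  interpret C: frozen_chain N d \<alpha> q "label_spin \<phi> (eta \<eta> (Suc n))"
    using assms by (intro chain eta_spin_configs)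
  show ?case using Suc C.closed unfolding fst_law_Suc by (auto simp del: set_map_pmf)
qed

text \<open>The second spins have settled after a single update, and the first spins use the updated values;
  hence \<open>N\<^sup>+\<close> follows the homogeneous chain from the very first epoch.\<close>

lemma law_settled:
  assumes "A\<^sub>3 = {}" "\<eta> \<in> spin_configs"
  shows "law k \<eta> (Suc n) =
    map_pmf (\<lambda>i. (i, rest \<eta>)) (law_after (K (rest \<eta>)) (Suc n) (return_pmf k))"
proof (induction n)
  case 0
  show ?case using law_Suc[of k \<eta> 0 \<eta> "return_pmf k"] step_eq_rest[OF assms]
    by (simp add: law_after_Suc del: frozen_law.simps(2))
next
  case (Suc n)
  show ?case using law_Suc[OF Suc] step_rest[OF assms]
    by (simp add: law_after_Suc del: frozen_law.simps(2))
qed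

lemma pmf_pair_const: "pmf (map_pmf (\<lambda>i. (i, \<zeta>)) \<mu>) (l, \<zeta>') = pmf \<mu> l * of_bool (\<zeta>' = \<zeta>)"
proof (cases "\<zeta>' = \<zeta>")
  case True
  then show ?thesis using pmf_map_inj'[of "\<lambda>i. (i, \<zeta>)" \<mu> l] by (simp add: inj_def)
next
  case False
  then show ?thesis by (auto simp: pmf_eq_0_set_pmf)
qed

lemma joint_inf_eq: "joint_inf N d \<alpha> \<gamma> q \<phi> \<eta> (l, \<zeta>) = weights \<eta> l * of_bool (\<zeta> = rest \<eta>)"
  by (simp add: joint_inf_def)

text \<open>The settled second spins are \<open>-1\<close> and \<open>1\<close> exactly on the sets that define the weights.\<close>

lemma label_spin_rest:
  assumes "A\<^sub>3 = {}" "\<eta> \<in> spin_configs"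
  shows "frozen_chain.Sm N (label_spin \<phi> (rest \<eta>)) = Sminus \<eta>"
    and "frozen_chain.Sp N (label_spin \<phi> (rest \<eta>)) = Splus \<eta>"
proof -
  interpret C: frozen_chain N d \<alpha> q "label_spin \<phi> (rest \<eta>)"
    using assms by (intro chain rest_spin_configs)
  have eq: "label_spin \<phi> (rest \<eta>) i =
      (if i \<in> A\<^sub>1 then 1 else if i \<in> A\<^sub>4 then -1 else \<eta> (inv \<phi> i))" if "i \<in> {1..N}" for i
    using that \<phi>_inv[OF that] by (simp add: label_spin_def settled_def)
  have "(i \<in> C.Sm \<longleftrightarrow> i \<in> Sminus \<eta>) \<and> (i \<in> C.Sp \<longleftrightarrow> i \<in> Splus \<eta>)" for i
  proof -
    consider "i \<notin> {1..N}" "i \<notin> A\<^sub>1" "i \<notin> A\<^sub>2" "i \<notin> A\<^sub>4"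
      | "i \<in> {1..N}" "i \<in> A\<^sub>1" "i \<notin> A\<^sub>2" "i \<notin> A\<^sub>4"
      | "i \<in> {1..N}" "i \<notin> A\<^sub>1" "i \<in> A\<^sub>2" "i \<notin> A\<^sub>4"
      | "i \<in> {1..N}" "i \<notin> A\<^sub>1" "i \<notin> A\<^sub>2" "i \<in> A\<^sub>4"
    proof -
      have "B_set N d \<alpha> \<gamma> q \<subseteq> {1..N}" "C_set N d \<alpha> \<gamma> q \<subseteq> {1..N}"
        by (auto simp: B_set_def C_set_def)
      then show ?thesis
        using that assms(1) unfolding A1_def A2_def A3_def A4_def by blast
    qed
    then show ?thesis
      unfolding C.Sm_def C.Sp_def S_minus_def S_plus_def mem_Collect_eq Un_iff
      by cases (auto simp: eq)
  qed
  then show "C.Sm = Sminus \<eta>" "C.Sp = Splus \<eta>" by blast+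
qed

lemma Nplus_converges:
  assumes "A\<^sub>3 = {}" "\<eta> \<in> spin_configs" "g_defined N d \<alpha> q (Splus \<eta>)"
    and "not_alternating N d \<alpha> q" "k \<le> N"
  shows "Nplus_limit_law N d \<alpha> \<gamma> q \<phi> k \<eta> (weights \<eta>)"
    and "joint_limit_law N d \<alpha> \<gamma> q \<phi> k \<eta> (joint_inf N d \<alpha> \<gamma> q \<phi> \<eta>)"
proof -
  interpret C: frozen_chain N d \<alpha> q "label_spin \<phi> (rest \<eta>)"
    using assms by (intro chain rest_spin_configs)
  have "(\<lambda>n. pmf (law_after (K (rest \<eta>)) n (return_pmf k)) l) \<longlonglongrightarrow> weights \<eta> l" for l
    using C.law_after_tendsto_p_inf[of k l] assms by (simp add: label_spin_rest)
  then have lim: "(\<lambda>n. pmf (law_after (K (rest \<eta>)) (Suc n) (return_pmf k)) l) \<longlonglongrightarrow> weights \<eta> l" for l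
    by (rule LIMSEQ_Suc)
  have "(\<lambda>n. pmf (map_pmf fst (law k \<eta> (Suc n))) l) \<longlonglongrightarrow> weights \<eta> l" for l
    using lim[of l] unfolding law_settled[OF assms(1,2)] by (simp add: pmf.map_comp o_def)
  then show "Nplus_limit_law N d \<alpha> \<gamma> q \<phi> k \<eta> (weights \<eta>)"
    unfolding Nplus_limit_law_def by (blast intro: LIMSEQ_imp_Suc)
  have "(\<lambda>n. pmf (law k \<eta> (Suc n)) (l, \<zeta>)) \<longlonglongrightarrow> joint_inf N d \<alpha> \<gamma> q \<phi> \<eta> (l, \<zeta>)" for l \<zeta>
    unfolding law_settled[OF assms(1,2)] pmf_pair_const joint_inf_eq
    by (intro tendsto_mult_right lim)
  then show "joint_limit_law N d \<alpha> \<gamma> q \<phi> k \<eta> (joint_inf N d \<alpha> \<gamma> q \<phi> \<eta>)"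
    unfolding joint_limit_law_def split_paired_All by (intro allI) (rule LIMSEQ_imp_Suc)
qed

lemma joint_stationary:
  assumes "A\<^sub>3 = {}" "\<eta> \<in> spin_configs" "g_defined N d \<alpha> q (Splus \<eta>)"
  shows "\<exists>\<mu>. stationary N d \<alpha> \<gamma> q \<phi> \<mu> \<and> pmf \<mu> = joint_inf N d \<alpha> \<gamma> q \<phi> \<eta>
    \<and> pmf (map_pmf fst \<mu>) = weights \<eta>"
proof -
  interpret C: frozen_chain N d \<alpha> q "label_spin \<phi> (rest \<eta>)"
    using assms by (intro chain rest_spin_configs)
  define \<mu> where "\<mu> = map_pmf (\<lambda>i. (i, rest \<eta>)) C.inv_law"
  have "set_pmf \<mu> \<subseteq> {0..N} \<times> spin_configs"
    using C.set_inv_law rest_spin_configs[OF assms(2)] by (auto simp: \<mu>_def)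
  moreover have "bind_pmf \<mu> (frozen_step N d \<alpha> \<gamma> q \<phi>)
      = map_pmf (\<lambda>i. (i, rest \<eta>)) (bind_pmf C.inv_law C.K)"
    by (simp add: \<mu>_def bind_map_pmf frozen_step_eq step_rest[OF assms(1,2)] map_bind_pmf)
  moreover have "bind_pmf C.inv_law C.K = C.inv_law"
    using assms by (intro C.inv_law_invariant) (simp add: label_spin_rest)
  ultimately have "stationary N d \<alpha> \<gamma> q \<phi> \<mu>"
    by (simp add: stationary_def \<mu>_def)
  moreover have "pmf \<mu> (l, \<zeta>) = joint_inf N d \<alpha> \<gamma> q \<phi> \<eta> (l, \<zeta>)" for l \<zeta>
    unfolding \<mu>_def pmf_pair_const joint_inf_eq C.pmf_inv_law label_spin_rest[OF assms(1,2)] ..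
  moreover have "pmf (map_pmf fst \<mu>) = weights \<eta>"
    using C.pmf_inv_law by (simp add: \<mu>_def pmf.map_comp o_def label_spin_rest[OF assms(1,2)])
  ultimately show ?thesis by (intro exI[of _ \<mu>]) (auto simp: fun_eq_iff)
qed

text \<open>Without \<open>A\<^sub>2\<close> and \<open>A\<^sub>3\<close> the configuration of settled second spins does not depend on the initial
  one, so every stationary law is carried by it and is determined by its \<open>N\<^sup>+\<close> marginal.\<close>

lemma stationary_unique:
  assumes empty: "A\<^sub>2 \<union> A\<^sub>3 = {}" and "\<eta> \<in> spin_configs" "g_defined N d \<alpha> q (Splus \<eta>)"
    and "stationary N d \<alpha> \<gamma> q \<phi> \<nu>" "stationary N d \<alpha> \<gamma> q \<phi> \<nu>'"
  shows "\<nu> = \<nu>'"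
proof -
  have A3: "A\<^sub>3 = {}" using empty by simp
  interpret C: frozen_chain N d \<alpha> q "label_spin \<phi> (rest \<eta>)"
    using assms by (intro chain rest_spin_configs)
  have rest: "rest \<eta>' x = rest \<eta> x" for \<eta>' x
    using empty by (cases x rule: labels_cases) (auto simp: settled_def)
  have "\<nu> = map_pmf (\<lambda>i. (i, rest \<eta>)) C.inv_law" if "stationary N d \<alpha> \<gamma> q \<phi> \<nu>" for \<nu>
  proof -
    define \<rho> where "\<rho> = bind_pmf (map_pmf fst \<nu>) C.K"
    have \<nu>: "set_pmf \<nu> \<subseteq> {0..N} \<times> spin_configs" "bind_pmf \<nu> (frozen_step N d \<alpha> \<gamma> q \<phi>) = \<nu>"
      using that by (auto simp: stationary_def)
    have "\<nu> = bind_pmf \<nu> (\<lambda>z. map_pmf (\<lambda>i. (i, rest \<eta>)) (C.K (fst z)))"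
    proof (subst \<nu>(2)[symmetric], intro bind_pmf_cong refl)
      fix z assume "z \<in> set_pmf \<nu>"
      then obtain i \<eta>' where z: "z = (i, \<eta>')" "\<eta>' \<in> spin_configs" using \<nu>(1) by blast
      then have "step \<eta>' = rest \<eta>"
        using step_eq_rest[OF A3] rest[of \<eta>'] by (simp add: fun_eq_iff)
      then show "frozen_step N d \<alpha> \<gamma> q \<phi> z = map_pmf (\<lambda>i. (i, rest \<eta>)) (C.K (fst z))"
        using z by (simp add: frozen_step_eq)
    qed
    then have \<nu>_eq: "\<nu> = map_pmf (\<lambda>i. (i, rest \<eta>)) \<rho>"
      by (simp add: \<rho>_def bind_map_pmf map_bind_pmf)
    then have fst_\<nu>: "map_pmf fst \<nu> = \<rho>" by (simp add: pmf.map_comp o_def)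
    then have "bind_pmf \<rho> C.K = \<rho>" by (simp add: \<rho>_def)
    moreover have "set_pmf \<rho> \<subseteq> {..N}" using \<nu>(1) by (auto simp flip: fst_\<nu>)
    ultimately have "\<rho> = C.inv_law"
      using assms A3 by (intro C.stationary_law_unique) (simp_all add: label_spin_rest)
    then show ?thesis using \<nu>_eq by simp
  qed
  then show ?thesis using assms by metis
qed

section \<open>Counting the limits\<close>

text \<open>If \<open>Pbar_mm\<close> is 1 at \<open>l\<close>, then \<open>Pbar_pp\<close> is 1 at the reflected label \<open>N - l\<close>. This leaves a nonnegative
  \<open>\<E>\<^sub>+\<close> there, which for \<open>q < 1\<close> puts \<open>N - l\<close> into \<open>A\<^sub>1\<close> and makes the denominator of \<open>g\<close> vanish at \<open>N - l\<close>.
  So meaningful weights force all upward rates to be positive.\<close>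

lemma Pbar_mm_less_1_if_g_defined:
  assumes "q < 1" "g_defined N d \<alpha> q S" "A\<^sub>1 \<subseteq> S" "l < N"
  shows "Pbar_mm N d \<alpha> l < 1"
proof (rule ccontr)
  assume "\<not> ?thesis"
  then have "Pbar_mm N d \<alpha> l = 1" using Pbar_mm_unit[of l N \<alpha> d] assms(4) \<alpha> by simp
  then have pp: "Pbar_pp N d \<alpha> (N - l) = 1"
    using assms(4) \<alpha> by (simp add: Pbar_pp_reflect)
  have i: "N - l \<in> {1..N}" using assms(4) by auto
  have "0 \<le> (1 - real (N - l) / real N) * (1 - Pbar_mm N d \<alpha> (N - l))"
  proof (cases "l = 0")
    case False
    then show ?thesis using Pbar_mm_unit[of "N - l" N \<alpha> d] \<alpha> assms(4)
      by (intro mult_nonneg_nonneg) auto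
  qed (use N in simp)
  then have E: "0 \<le> E_plus N d \<alpha> \<gamma> (N - l)" by (simp add: E_plus_def pp)
  have neg: "1 - 1 / q < 0" using assms(1) q by simp
  have "(1 - 1 / q) * (1 - real (N - l) / real N) \<le> 0"
    using neg i by (intro mult_nonpos_nonneg) auto
  moreover have "(1 - 1 / q) * (real (N - l) / real N) < 0"
    using neg i by (intro mult_neg_pos) auto
  ultimately have "N - l \<in> A\<^sub>1"
    using E i by (auto simp: A1_def B_set_def C_set_def)
  then have "N - l \<in> S" using assms(3) by auto
  moreover have "1 - q * Pbar_pp N d \<alpha> (N - l) - (1 - q) * indicator S (N - l) \<noteq> 0"
    using assms(2) i unfolding g_defined_def by blast
  ultimately show False by (simp add: pp)
qed

text \<open>All states have positive weight, so the weights fix all second spins successively.\<close>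

lemma weights_determine_spins:
  assumes "A\<^sub>3 = {}" "q < 1" "\<eta> \<in> spin_configs" "\<eta>' \<in> spin_configs"
    and "g_defined N d \<alpha> q (Splus \<eta>)" "g_defined N d \<alpha> q (Splus \<eta>')"
    and eq: "weights \<eta> = weights \<eta>'" and "\<phi> x \<in> A\<^sub>2"
  shows "\<eta> x = \<eta>' x"
proof -
  interpret A: frozen_chain N d \<alpha> q "label_spin \<phi> (rest \<eta>)"
    using assms by (intro chain rest_spin_configs)
  interpret B: frozen_chain N d \<alpha> q "label_spin \<phi> (rest \<eta>')"
    using assms by (intro chain rest_spin_configs)
  have A: "g_defined N d \<alpha> q A.Sp" and B: "g_defined N d \<alpha> q B.Sp"
    using assms by (simp_all add: label_spin_rest)
  have p: "A.p_inf = B.p_inf" using assms by (simp add: label_spin_rest)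
  have "A\<^sub>1 \<subseteq> A.Sp" using assms by (simp add: label_spin_rest S_plus_def)
  then have up: "0 < A.up i" if "i < N" for i
    using that Pbar_mm_less_1_if_g_defined[OF \<open>q < 1\<close> A] by (intro A.up_pos) auto
  have down: "0 < A.down i" if "i \<in> {1..N}" for i
    using that A by (simp add: A.g_defined_iff_down)
  have pos: "0 < A.p_inf i" if "i \<in> {1..N}" for i
    using that by (intro A.balance_pos[OF down up A.p_inf_balance[OF A] A.p_inf_sum A.p_inf_nonneg]) auto
  have "label_spin \<phi> (rest \<eta>) (\<phi> x) = label_spin \<phi> (rest \<eta>') (\<phi> x)"
    using \<phi>_range[of x] A.p_inf_balance[OF A] B.p_inf_balance[OF B] pos
    by (intro balance_determines_spins[OF A.frozen_chain_axioms B.frozen_chain_axioms \<open>q < 1\<close>,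
          of A.p_inf]) (auto simp: p)
  then show ?thesis
    using \<phi>_range[of x] assms(8) by (simp add: label_spin_def inv_\<phi> rest_A2)
qed

text \<open>The state \<open>N\<^sup>+ = 0\<close> has positive weight, so the law shows which second spins carry it.\<close>

lemma joint_inf_determines_spins:
  assumes "A\<^sub>3 = {}" "\<eta> \<in> spin_configs"
    and eq: "joint_inf N d \<alpha> \<gamma> q \<phi> \<eta> = joint_inf N d \<alpha> \<gamma> q \<phi> \<eta>'" and "\<phi> x \<in> A\<^sub>2"
  shows "\<eta> x = \<eta>' x"
proof -
  interpret A: frozen_chain N d \<alpha> q "label_spin \<phi> (rest \<eta>)"
    using assms by (intro chain rest_spin_configs)
  have "0 < joint_inf N d \<alpha> \<gamma> q \<phi> \<eta> (0, rest \<eta>)"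
    using A.p_inf_0 by (simp add: joint_inf_eq label_spin_rest[OF assms(1,2)])
  then have "0 < joint_inf N d \<alpha> \<gamma> q \<phi> \<eta>' (0, rest \<eta>)" by (simp only: eq)
  then have "rest \<eta> = rest \<eta>'"
    by (cases "rest \<eta> = rest \<eta>'") (simp_all add: joint_inf_eq)
  then show ?thesis using rest_A2[OF assms(4)] by metis
qed

definition extend :: "(nat \<Rightarrow> int) \<Rightarrow> 'y \<Rightarrow> int" where
  "extend \<sigma> x = (if \<phi> x \<in> A\<^sub>2 then \<sigma> (\<phi> x) else 1)"

abbreviation "assignments \<equiv> A\<^sub>2 \<rightarrow>\<^sub>E {-1, 1 :: int}"

lemma A2_subset: "A\<^sub>2 \<subseteq> {1..N}"
  by (auto simp: A2_def B_set_def)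

lemma extend_spin_configs: "\<sigma> \<in> assignments \<Longrightarrow> extend \<sigma> \<in> spin_configs"
  by (auto simp: extend_def spin_configs_def)

lemma extend_A2: "i \<in> A\<^sub>2 \<Longrightarrow> extend \<sigma> (inv \<phi> i) = \<sigma> i"
  using A2_subset \<phi>_inv[of i] by (auto simp: extend_def)

lemma weights_extend:
  "weights (extend \<sigma>) = pi_inf N d \<alpha> q (S_minus N d \<alpha> \<gamma> q \<sigma>) (S_plus N d \<alpha> \<gamma> q \<sigma>)"
  by (simp add: S_minus_def S_plus_def extend_A2 cong: conj_cong)

lemma extend_surj:
  assumes "\<eta> \<in> spin_configs"
  obtains \<sigma> where "\<sigma> \<in> assignments" "\<And>x. \<phi> x \<in> A\<^sub>2 \<Longrightarrow> extend \<sigma> x = \<eta> x"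
proof
  show "restrict (\<lambda>i. \<eta> (inv \<phi> i)) A\<^sub>2 \<in> assignments"
    using assms by (auto simp: spin_configs_def)
qed (simp add: extend_def inv_\<phi>)

lemma S_cong:
  assumes "\<And>x. \<phi> x \<in> A\<^sub>2 \<Longrightarrow> \<eta> x = \<eta>' x"
  shows "Sminus \<eta> = Sminus \<eta>'" "Splus \<eta> = Splus \<eta>'"
proof -
  have eq: "\<eta> (inv \<phi> i) = \<eta>' (inv \<phi> i)" if "i \<in> A\<^sub>2" for i
    using assms[of "inv \<phi> i"] that A2_subset \<phi>_inv[of i] by auto
  show "Sminus \<eta> = Sminus \<eta>'" using eq by (auto simp: S_minus_def)
  show "Splus \<eta> = Splus \<eta>'" using eq by (auto simp: S_plus_def)
qed

lemma joint_inf_cong: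
  assumes "A\<^sub>3 = {}" "\<And>x. \<phi> x \<in> A\<^sub>2 \<Longrightarrow> \<eta> x = \<eta>' x"
  shows "joint_inf N d \<alpha> \<gamma> q \<phi> \<eta> = joint_inf N d \<alpha> \<gamma> q \<phi> \<eta>'"
proof -
  have "rest \<eta> x = rest \<eta>' x" for x
    using assms by (cases x rule: labels_cases) (auto simp: settled_def)
  then have "rest \<eta> = rest \<eta>'" by auto
  moreover have "Sminus \<eta> = Sminus \<eta>'" "Splus \<eta> = Splus \<eta>'"
    using S_cong[of \<eta> \<eta>'] assms(2) by blast+
  ultimately show ?thesis by (simp add: joint_inf_def)
qed

lemma card_assignments: "card assignments = 2 ^ card A\<^sub>2"
  using finite_subset[OF A2_subset] by (simp add: card_funcsetE numeral_2_eq_2)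

lemma extend_eqI:
  assumes "\<sigma> \<in> assignments" "\<sigma>' \<in> assignments"
    and "\<And>x. \<phi> x \<in> A\<^sub>2 \<Longrightarrow> extend \<sigma> x = extend \<sigma>' x"
  shows "\<sigma> = \<sigma>'"
proof (rule PiE_ext[OF assms(1,2)])
  fix i assume i: "i \<in> A\<^sub>2"
  then have "\<phi> (inv \<phi> i) \<in> A\<^sub>2" using A2_subset \<phi>_inv[of i] by auto
  then show "\<sigma> i = \<sigma>' i" using assms(3)[of "inv \<phi> i"] i by (simp add: extend_A2)
qed

lemma card_joint_limit_laws:
  assumes "A\<^sub>3 = {}" "\<forall>\<eta>\<in>spin_configs. g_defined N d \<alpha> q (Splus \<eta>)" "not_alternating N d \<alpha> q"
  shows "card (joint_limit_laws N d \<alpha> \<gamma> q \<phi>) = 2 ^ card A\<^sub>2"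
proof -
  let ?J = "joint_inf N d \<alpha> \<gamma> q \<phi>"
  have lim: "joint_limit_law N d \<alpha> \<gamma> q \<phi> k \<eta> p \<longleftrightarrow> p = ?J \<eta>"
    if "k \<le> N" "\<eta> \<in> spin_configs" for k \<eta> p
  proof
    assume "joint_limit_law N d \<alpha> \<gamma> q \<phi> k \<eta> p"
    moreover have "joint_limit_law N d \<alpha> \<gamma> q \<phi> k \<eta> (?J \<eta>)"
      using Nplus_converges(2)[of \<eta> k] that assms by blast
    ultimately show "p = ?J \<eta>"
      unfolding joint_limit_law_def by (intro ext) (blast intro: LIMSEQ_unique)
  qed (use Nplus_converges(2)[of \<eta> k] that assms in auto)
  have "joint_limit_laws N d \<alpha> \<gamma> q \<phi> = ?J ` spin_configs"
  proof (intro equalityI subsetI)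
    fix p assume "p \<in> ?J ` spin_configs"
    then obtain \<eta> where "\<eta> \<in> spin_configs" "p = ?J \<eta>" by blast
    then have "joint_limit_law N d \<alpha> \<gamma> q \<phi> 0 \<eta> p" using lim[of 0 \<eta> p] by blast
    then show "p \<in> joint_limit_laws N d \<alpha> \<gamma> q \<phi>"
      using \<open>\<eta> \<in> spin_configs\<close> unfolding joint_limit_laws_def by blast
  qed (use lim in \<open>auto simp: joint_limit_laws_def\<close>)
  also have "\<dots> = (\<lambda>\<sigma>. ?J (extend \<sigma>)) ` assignments"
  proof (intro equalityI subsetI)
    fix p assume "p \<in> ?J ` spin_configs"
    then obtain \<eta> where \<eta>: "\<eta> \<in> spin_configs" "p = ?J \<eta>" by auto
    obtain \<sigma> where "\<sigma> \<in> assignments" "\<And>x. \<phi> x \<in> A\<^sub>2 \<Longrightarrow> extend \<sigma> x = \<eta> x"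
      using extend_surj[OF \<eta>(1)] by blast
    then show "p \<in> (\<lambda>\<sigma>. ?J (extend \<sigma>)) ` assignments"
      using joint_inf_cong[OF assms(1), of "extend \<sigma>" \<eta>] \<eta>(2)
      by (intro image_eqI[of _ _ \<sigma>]) auto
  qed (auto intro: extend_spin_configs)
  finally have "joint_limit_laws N d \<alpha> \<gamma> q \<phi> = (\<lambda>\<sigma>. ?J (extend \<sigma>)) ` assignments" .
  moreover have "inj_on (\<lambda>\<sigma>. ?J (extend \<sigma>)) assignments"
    by (intro inj_onI extend_eqI joint_inf_determines_spins[OF assms(1)])
       (auto intro: extend_spin_configs)
  ultimately show ?thesis by (simp add: card_image card_assignments)
qed

lemma bij_Nplus_limit_laws:
  assumes "A\<^sub>3 = {}" "\<forall>\<eta>\<in>spin_configs. g_defined N d \<alpha> q (Splus \<eta>)" "q < 1"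
  shows "bij_betw (\<lambda>\<sigma>. pi_inf N d \<alpha> q (S_minus N d \<alpha> \<gamma> q \<sigma>) (S_plus N d \<alpha> \<gamma> q \<sigma>))
    assignments (Nplus_limit_laws N d \<alpha> \<gamma> q \<phi>)"
proof -
  have na: "not_alternating N d \<alpha> q" using assms(3) by (simp add: not_alternating_def)
  have lim: "Nplus_limit_law N d \<alpha> \<gamma> q \<phi> k \<eta> p \<longleftrightarrow> p = weights \<eta>"
    if "k \<le> N" "\<eta> \<in> spin_configs" for k \<eta> p
  proof
    assume "Nplus_limit_law N d \<alpha> \<gamma> q \<phi> k \<eta> p"
    moreover have "Nplus_limit_law N d \<alpha> \<gamma> q \<phi> k \<eta> (weights \<eta>)"
      using Nplus_converges(1)[of \<eta> k] that assms na by blast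
    ultimately show "p = weights \<eta>"
      unfolding Nplus_limit_law_def by (intro ext) (blast intro: LIMSEQ_unique)
  qed (use Nplus_converges(1)[of \<eta> k] that assms na in auto)
  have "Nplus_limit_laws N d \<alpha> \<gamma> q \<phi> = weights ` spin_configs"
  proof (intro equalityI subsetI)
    fix p assume "p \<in> weights ` spin_configs"
    then obtain \<eta> where "\<eta> \<in> spin_configs" "p = weights \<eta>" by blast
    then have "Nplus_limit_law N d \<alpha> \<gamma> q \<phi> 0 \<eta> p" using lim[of 0 \<eta> p] by blast
    then show "p \<in> Nplus_limit_laws N d \<alpha> \<gamma> q \<phi>"
      using \<open>\<eta> \<in> spin_configs\<close> unfolding Nplus_limit_laws_def by blast
  qed (use lim in \<open>auto simp: Nplus_limit_laws_def\<close>)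
  also have "\<dots> = (\<lambda>\<sigma>. weights (extend \<sigma>)) ` assignments"
  proof (intro equalityI subsetI)
    fix p assume "p \<in> weights ` spin_configs"
    then obtain \<eta> where \<eta>: "\<eta> \<in> spin_configs" "p = weights \<eta>" by auto
    obtain \<sigma> where \<sigma>: "\<sigma> \<in> assignments" "\<And>x. \<phi> x \<in> A\<^sub>2 \<Longrightarrow> extend \<sigma> x = \<eta> x"
      using extend_surj[OF \<eta>(1)] by blast
    have "weights (extend \<sigma>) = weights \<eta>"
      using S_cong[of "extend \<sigma>" \<eta>] \<sigma>(2) by simp
    then show "p \<in> (\<lambda>\<sigma>. weights (extend \<sigma>)) ` assignments"
      using \<sigma>(1) \<eta>(2) by (intro image_eqI[of _ _ \<sigma>]) auto
  qed (auto intro: extend_spin_configs)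
  finally have "Nplus_limit_laws N d \<alpha> \<gamma> q \<phi> = (\<lambda>\<sigma>. weights (extend \<sigma>)) ` assignments" .
  moreover have "inj_on (\<lambda>\<sigma>. weights (extend \<sigma>)) assignments"
    using assms by (intro inj_onI extend_eqI weights_determine_spins)
       (auto intro: extend_spin_configs)
  ultimately show ?thesis by (simp add: bij_betw_def weights_extend)
qed

section \<open>Oscillating second spins\<close>

lemma eta_A3_flips:
  assumes "\<eta> \<in> spin_configs" "\<phi> x \<in> A\<^sub>3"
  shows "eta \<eta> (Suc n) x \<noteq> eta \<eta> n x"
  using step_A3[OF eta_spin_configs[OF assms(1)] assms(2), of n]
    spin_cases[OF eta_spin_configs[OF assms(1)], of n x]
  by (auto simp: eta_Suc)

lemma eta_A3_not_settling:
  assumes "\<eta> \<in> spin_configs" "\<phi> x \<in> A\<^sub>3"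
  shows "\<not> (\<exists>v. \<forall>\<^sub>F n in sequentially. eta \<eta> n x = v)"
proof
  assume "\<exists>v. \<forall>\<^sub>F n in sequentially. eta \<eta> n x = v"
  then obtain v n0 where "\<And>n. n0 \<le> n \<Longrightarrow> eta \<eta> n x = v"
    by (auto simp: eventually_sequentially)
  from this[of n0] this[of "Suc n0"] show False
    using eta_A3_flips[OF assms, of n0] by simp
qed

lemma finite_spin_configs: "finite (spin_configs :: ('y \<Rightarrow> int) set)"
proof -
  have "finite (PiE (UNIV :: 'y set) (\<lambda>_. {-1, 1 :: int}))"
    by (intro finite_PiE) auto
  then show ?thesis by (rule finite_subset[rotated]) (auto simp: spin_configs_def)
qed

text \<open>No configuration of second spins is occupied at two consecutive epochs. A limit would vanish
  everywhere, although the total mass on the finite state space is 1.\<close>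

lemma no_joint_limit:
  assumes "\<phi> x \<in> A\<^sub>3" "k \<le> N" "\<eta> \<in> spin_configs"
  shows "\<not> joint_limit_law N d \<alpha> \<gamma> q \<phi> k \<eta> p"
proof
  assume "joint_limit_law N d \<alpha> \<gamma> q \<phi> k \<eta> p"
  then have lim: "(\<lambda>n. pmf (law k \<eta> n) z) \<longlonglongrightarrow> p z" for z
    unfolding joint_limit_law_def by blast
  have pmf0: "pmf (law k \<eta> n) (l, \<zeta>) = 0" if "\<zeta> \<noteq> eta \<eta> n" for n l \<zeta>
    using that by (subst law_product) (simp add: pmf_pair_const del: frozen_law.simps)
  have "p z = 0" for z
  proof -
    obtain l \<zeta> where z: "z = (l, \<zeta>)" by (cases z)
    have "\<zeta> \<noteq> eta \<eta> n \<or> \<zeta> \<noteq> eta \<eta> (Suc n)" for n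
      using eta_A3_flips[OF assms(3,1), of n] by auto
    then have zero: "pmf (law k \<eta> n) z * pmf (law k \<eta> (Suc n)) z = 0" for n
      using pmf0 unfolding z by (metis mult_eq_0_iff)
    have "(\<lambda>n. pmf (law k \<eta> n) z * pmf (law k \<eta> (Suc n)) z) \<longlonglongrightarrow> p z * p z"
      by (intro tendsto_mult lim LIMSEQ_Suc[OF lim])
    then have "p z * p z = 0" unfolding zero by (simp add: LIMSEQ_const_iff)
    then show ?thesis by simp
  qed
  note p0 = this
  define F where "F = {..N} \<times> (spin_configs :: ('y \<Rightarrow> int) set)"
  have total: "(\<Sum>z\<in>F. pmf (law k \<eta> n) z) = 1" for n
  proof (rule sum_pmf_eq_1)
    show "finite F" by (simp add: F_def finite_spin_configs)
    define \<mu> where "\<mu> = map_pmf fst (law k \<eta> n)"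
    have "set_pmf \<mu> \<subseteq> {..N}" unfolding \<mu>_def by (rule set_fst_law[OF assms(2,3)])
    moreover have "law k \<eta> n = map_pmf (\<lambda>i. (i, eta \<eta> n)) \<mu>"
      unfolding \<mu>_def by (rule law_product)
    ultimately show "set_pmf (law k \<eta> n) \<subseteq> F"
      using eta_spin_configs[OF assms(3), of n] by (auto simp: F_def)
  qed
  have "(\<lambda>n. \<Sum>z\<in>F. pmf (law k \<eta> n) z) \<longlonglongrightarrow> (\<Sum>z\<in>F. p z)"
    by (intro tendsto_sum lim)
  then show False unfolding total p0 by (simp add: LIMSEQ_const_iff)
qed

text \<open>From the first epoch on, two kernels alternate. A limit of the laws is stationary for both, hence
  in balance for both, and positive everywhere since \<open>\<alpha> > 2 d\<close> makes all rates positive. Then both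
  kernels have the same second spins, but the second spins on \<open>A\<^sub>3\<close> differ.\<close>

lemma no_Nplus_limit:
  assumes "2 * real d < \<alpha>" "\<phi> x \<in> A\<^sub>3" "k \<le> N" "\<eta> \<in> spin_configs"
  shows "\<not> Nplus_limit_law N d \<alpha> \<gamma> q \<phi> k \<eta> p"
proof
  assume "Nplus_limit_law N d \<alpha> \<gamma> q \<phi> k \<eta> p"
  then have lim: "(\<lambda>n. pmf (map_pmf fst (law k \<eta> n)) l) \<longlonglongrightarrow> p l" for l
    by (simp add: Nplus_limit_law_def)
  have "q < 1"
    using assms(2) q by (cases "q = 1") (auto simp: A3_def B_set_def C_set_def)
  have p_nonneg: "0 \<le> p i" for i
    using lim[of i] by (rule LIMSEQ_le_const) simp
  have total: "(\<Sum>i\<le>N. pmf (map_pmf fst (law k \<eta> n)) i) = 1" for n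
    by (rule sum_pmf_eq_1[OF finite_atMost set_fst_law[OF assms(3,4)]])
  have "(\<lambda>n. \<Sum>i\<le>N. pmf (map_pmf fst (law k \<eta> n)) i) \<longlonglongrightarrow> (\<Sum>i\<le>N. p i)"
    by (intro tendsto_sum lim)
  then have p_sum: "(\<Sum>i\<le>N. p i) = 1"
    unfolding total by (simp add: LIMSEQ_const_iff)
  have stat: "p y = (\<Sum>x\<le>N. p x * pmf (K \<zeta> x) y)"
    if r: "strict_mono r" "\<And>m. eta \<eta> (Suc (r m)) = \<zeta>" for r :: "nat \<Rightarrow> nat" and \<zeta> y
  proof -
    have "pmf (map_pmf fst (law k \<eta> (Suc (r m)))) y =
        (\<Sum>x\<le>N. pmf (map_pmf fst (law k \<eta> (r m))) x * pmf (K \<zeta> x) y)" for m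
      unfolding fst_law_Suc r by (rule pmf_bind_finite[OF finite_atMost set_fst_law[OF assms(3,4)]])
    moreover have "(\<lambda>m. pmf (map_pmf fst (law k \<eta> (Suc (r m)))) y) \<longlonglongrightarrow> p y"
      using LIMSEQ_subseq_LIMSEQ[OF LIMSEQ_Suc[OF lim] r(1)] by (simp add: o_def)
    moreover have "(\<lambda>m. \<Sum>x\<le>N. pmf (map_pmf fst (law k \<eta> (r m))) x * pmf (K \<zeta> x) y)
        \<longlonglongrightarrow> (\<Sum>x\<le>N. p x * pmf (K \<zeta> x) y)"
      using LIMSEQ_subseq_LIMSEQ[OF lim r(1)] by (intro tendsto_intros) (simp add: o_def)
    ultimately show ?thesis by (simp only: LIMSEQ_unique)
  qed
  have stat1: "p y = (\<Sum>x\<le>N. p x * pmf (K (eta \<eta> 1) x) y)" for y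
    using eta_odd[OF assms(4)] by (intro stat[of "\<lambda>m. 2 * m"]) (auto simp: strict_mono_def)
  have stat2: "p y = (\<Sum>x\<le>N. p x * pmf (K (eta \<eta> 2) x) y)" for y
    using eta_even[OF assms(4)] by (intro stat[of "\<lambda>m. 2 * m + 1"]) (auto simp: strict_mono_def)
  interpret A: frozen_chain N d \<alpha> q "label_spin \<phi> (eta \<eta> 1)"
    using assms by (intro chain eta_spin_configs)
  interpret B: frozen_chain N d \<alpha> q "label_spin \<phi> (eta \<eta> 2)"
    using assms by (intro chain eta_spin_configs)
  have balA: "p i * A.up i = p (Suc i) * A.down (Suc i)" if "i < N" for i
    by (rule A.stationary_imp_balance[OF stat1 that])
  have balB: "p i * B.up i = p (Suc i) * B.down (Suc i)" if "i < N" for i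
    by (rule B.stationary_imp_balance[OF stat2 that])
  have mm: "Pbar_mm N d \<alpha> i < 1" if "i < N" for i
    using that d N assms(1) by (intro Pbar_mm_less_1) auto
  have upA: "0 < A.up i" if "i < N" for i
    using that mm by (intro A.up_pos)
  have downA: "0 < A.down i" if "i \<in> {1..N}" for i
  proof -
    have "Pbar_pp N d \<alpha> i < 1"
      using mm[of "N - i"] Pbar_pp_reflect[of "N - i" N \<alpha> d] that \<alpha> by auto
    then show ?thesis using that by (intro A.down_pos)
  qed
  have "0 < p i" if "i \<in> {1..N}" for i
    using that by (intro A.balance_pos[OF downA upA balA p_sum]) (auto simp: p_nonneg)
  then have "label_spin \<phi> (eta \<eta> 1) (\<phi> x) = label_spin \<phi> (eta \<eta> 2) (\<phi> x)"
    using \<phi>_range[of x] balA balB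
    by (intro balance_determines_spins[OF A.frozen_chain_axioms B.frozen_chain_axioms \<open>q < 1\<close>, of p])
       auto
  then have "eta \<eta> 1 x = eta \<eta> (Suc 1) x"
    using \<phi>_range[of x] by (simp add: label_spin_def inv_\<phi> numeral_2_eq_2)
  then show False using eta_A3_flips[OF assms(4,2), of 1] by simp
qed

end

section \<open>Limit laws and stationary laws\<close>

theorem theorem3p2:
  fixes N d :: nat and \<alpha> \<gamma> q :: real and \<phi> :: "'y::finite \<Rightarrow> nat"
  assumes "d \<ge> 1" and "N \<ge> 2 * d + 1" and "\<alpha> > 0" and "\<gamma> \<le> 0" and "0 < q" and "q \<le> 1"
    and "bij_betw \<phi> UNIV {1..N}"
  shows
    "\<comment> \<open>(a)\<close>
     (A2 N d \<alpha> \<gamma> q \<union> A3 N d \<alpha> \<gamma> q = {} \<and> g_defined N d \<alpha> q (A1 N d \<alpha> \<gamma> q) \<longrightarrow>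
        (not_alternating N d \<alpha> q \<longrightarrow>
           (\<forall>k\<le>N. \<forall>\<eta>\<in>spin_configs.
              Nplus_limit_law N d \<alpha> \<gamma> q \<phi> k \<eta> (pi_inf N d \<alpha> q (A4 N d \<alpha> \<gamma> q) (A1 N d \<alpha> \<gamma> q)))) \<and>
        (\<exists>\<mu>. {\<nu>. stationary N d \<alpha> \<gamma> q \<phi> \<nu>} = {\<mu>} \<and>
           pmf (map_pmf fst \<mu>) = pi_inf N d \<alpha> q (A4 N d \<alpha> \<gamma> q) (A1 N d \<alpha> \<gamma> q)))
     \<and>
     \<comment> \<open>(b)\<close>
     (A3 N d \<alpha> \<gamma> q = {} \<and> A2 N d \<alpha> \<gamma> q \<noteq> {} \<longrightarrow>
        (\<forall>\<eta>\<in>spin_configs.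
           (\<forall>\<^sub>F n in sequentially. eta2_at N d \<alpha> \<gamma> q \<phi> \<eta> n = settled N d \<alpha> \<gamma> q \<phi> \<eta>) \<and>
           (\<forall>x. \<phi> x \<in> A2 N d \<alpha> \<gamma> q \<longrightarrow> settled N d \<alpha> \<gamma> q \<phi> \<eta> x = \<eta> x)) \<and>
        (\<forall>\<eta>\<in>spin_configs. g_defined N d \<alpha> q (S_plus N d \<alpha> \<gamma> q (\<lambda>i. \<eta> (inv \<phi> i))) \<longrightarrow>
           (\<exists>\<mu>. stationary N d \<alpha> \<gamma> q \<phi> \<mu> \<and> pmf \<mu> = joint_inf N d \<alpha> \<gamma> q \<phi> \<eta>) \<and>
           (not_alternating N d \<alpha> q \<longrightarrow>
              (\<forall>k\<le>N.
                 joint_limit_law N d \<alpha> \<gamma> q \<phi> k \<eta> (joint_inf N d \<alpha> \<gamma> q \<phi> \<eta>) \<and>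
                 Nplus_limit_law N d \<alpha> \<gamma> q \<phi> k \<eta>
                   (pi_inf N d \<alpha> q (S_minus N d \<alpha> \<gamma> q (\<lambda>i. \<eta> (inv \<phi> i)))
                                   (S_plus N d \<alpha> \<gamma> q (\<lambda>i. \<eta> (inv \<phi> i))))))) \<and>
        ((\<forall>\<eta>\<in>spin_configs. g_defined N d \<alpha> q (S_plus N d \<alpha> \<gamma> q (\<lambda>i. \<eta> (inv \<phi> i)))) \<longrightarrow>
           (not_alternating N d \<alpha> q \<longrightarrow>
              card (joint_limit_laws N d \<alpha> \<gamma> q \<phi>) = 2 ^ card (A2 N d \<alpha> \<gamma> q)) \<and>
           (q < 1 \<longrightarrow>
              (\<exists>k\<le>N. \<exists>\<eta>\<in>spin_configs. \<exists>\<eta>'\<in>spin_configs. \<exists>p p'.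
                 Nplus_limit_law N d \<alpha> \<gamma> q \<phi> k \<eta> p \<and> Nplus_limit_law N d \<alpha> \<gamma> q \<phi> k \<eta>' p' \<and> p \<noteq> p') \<and>
              bij_betw (\<lambda>\<sigma>. pi_inf N d \<alpha> q (S_minus N d \<alpha> \<gamma> q \<sigma>) (S_plus N d \<alpha> \<gamma> q \<sigma>))
                (A2 N d \<alpha> \<gamma> q \<rightarrow>\<^sub>E {-1, 1}) (Nplus_limit_laws N d \<alpha> \<gamma> q \<phi>) \<and>
              card (Nplus_limit_laws N d \<alpha> \<gamma> q \<phi>) = 2 ^ card (A2 N d \<alpha> \<gamma> q))))
     \<and>
     \<comment> \<open>(c)\<close>
     (A3 N d \<alpha> \<gamma> q \<noteq> {} \<longrightarrow>
        (\<forall>k\<le>N. \<forall>\<eta>\<in>spin_configs.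
           (\<forall>x. \<phi> x \<in> A3 N d \<alpha> \<gamma> q \<longrightarrow>
              \<not> (\<exists>v. \<forall>\<^sub>F n in sequentially. eta2_at N d \<alpha> \<gamma> q \<phi> \<eta> n x = v)) \<and>
           \<not> (\<exists>p. joint_limit_law N d \<alpha> \<gamma> q \<phi> k \<eta> p) \<and>
           (2 * real d < \<alpha> \<longrightarrow> \<not> (\<exists>p. Nplus_limit_law N d \<alpha> \<gamma> q \<phi> k \<eta> p))))"
proof -
  interpret P: frozen_process N d \<alpha> \<gamma> q \<phi>
    using assms(1-3,5-7) by unfold_locales auto
  let ?const = "\<lambda>_ :: 'y. 1 :: int"
  have const: "?const \<in> spin_configs" by (simp add: spin_configs_def)
  have part_a: "(not_alternating N d \<alpha> q \<longrightarrow>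
         (\<forall>k\<le>N. \<forall>\<eta>\<in>spin_configs.
            Nplus_limit_law N d \<alpha> \<gamma> q \<phi> k \<eta> (pi_inf N d \<alpha> q P.A\<^sub>4 P.A\<^sub>1))) \<and>
      (\<exists>\<mu>. {\<nu>. stationary N d \<alpha> \<gamma> q \<phi> \<nu>} = {\<mu>} \<and>
         pmf (map_pmf fst \<mu>) = pi_inf N d \<alpha> q P.A\<^sub>4 P.A\<^sub>1)"
    if A23: "P.A\<^sub>2 \<union> P.A\<^sub>3 = {}" and gd: "g_defined N d \<alpha> q P.A\<^sub>1"
  proof -
    have A3: "P.A\<^sub>3 = {}" using A23 by simp
    have S: "S_minus N d \<alpha> \<gamma> q \<sigma> = P.A\<^sub>4" "S_plus N d \<alpha> \<gamma> q \<sigma> = P.A\<^sub>1" for \<sigma>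
      using A23 by (auto simp: S_minus_def S_plus_def)
    obtain \<mu> where \<mu>: "stationary N d \<alpha> \<gamma> q \<phi> \<mu>"
        "pmf (map_pmf fst \<mu>) = pi_inf N d \<alpha> q P.A\<^sub>4 P.A\<^sub>1"
      using P.joint_stationary[OF A3 const] gd unfolding S by blast
    moreover have "\<nu> = \<mu>" if "stationary N d \<alpha> \<gamma> q \<phi> \<nu>" for \<nu>
      using P.stationary_unique[OF A23 const _ that \<mu>(1)] gd unfolding S by blast
    ultimately have "{\<nu>. stationary N d \<alpha> \<gamma> q \<phi> \<nu>} = {\<mu>}" by blast
    moreover have "Nplus_limit_law N d \<alpha> \<gamma> q \<phi> k \<eta> (pi_inf N d \<alpha> q P.A\<^sub>4 P.A\<^sub>1)"
      if "not_alternating N d \<alpha> q" "k \<le> N" "\<eta> \<in> spin_configs" for k \<eta>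
      using P.Nplus_converges(1)[OF A3 that(3) _ that(1,2)] gd unfolding S by blast
    ultimately show ?thesis using \<mu>(2) by blast
  qed
  have settle: "(\<forall>\<^sub>F n in sequentially. P.eta \<eta> n = P.rest \<eta>) \<and>
      (\<forall>x. \<phi> x \<in> P.A\<^sub>2 \<longrightarrow> P.rest \<eta> x = \<eta> x)"
    if "P.A\<^sub>3 = {}" "\<eta> \<in> spin_configs" for \<eta>
  proof -
    have "P.eta \<eta> n = P.rest \<eta>" if "n \<ge> 1" for n
      using P.eta_settles[OF \<open>P.A\<^sub>3 = {}\<close> \<open>\<eta> \<in> spin_configs\<close>, of "n - 1"] that by simp
    then show ?thesis
      using P.rest_A2 unfolding eventually_sequentially by blast
  qed
  have differ: "\<exists>k\<le>N. \<exists>\<eta>\<in>spin_configs. \<exists>\<eta>'\<in>spin_configs. \<exists>p p'.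
      Nplus_limit_law N d \<alpha> \<gamma> q \<phi> k \<eta> p \<and> Nplus_limit_law N d \<alpha> \<gamma> q \<phi> k \<eta>' p' \<and> p \<noteq> p'"
    if A3: "P.A\<^sub>3 = {}" and A2: "P.A\<^sub>2 \<noteq> {}" and "q < 1"
      and gd: "\<forall>\<eta>\<in>spin_configs. g_defined N d \<alpha> q (P.Splus \<eta>)"
  proof -
    have na: "not_alternating N d \<alpha> q" using \<open>q < 1\<close> by (simp add: not_alternating_def)
    let ?minus = "\<lambda>_ :: 'y. - 1 :: int"
    have minus: "?minus \<in> spin_configs" by (simp add: spin_configs_def)
    obtain i where "i \<in> P.A\<^sub>2" using A2 by blast
    then have "\<phi> (inv \<phi> i) \<in> P.A\<^sub>2" using P.A2_subset P.\<phi>_inv[of i] by auto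
    then have "P.weights ?const \<noteq> P.weights ?minus"
      using P.weights_determine_spins[OF A3 \<open>q < 1\<close> const minus] gd const minus
      by fastforce
    moreover have "Nplus_limit_law N d \<alpha> \<gamma> q \<phi> 0 ?const (P.weights ?const)"
      by (rule P.Nplus_converges(1)[OF A3 const bspec[OF gd const] na]) simp
    moreover have "Nplus_limit_law N d \<alpha> \<gamma> q \<phi> 0 ?minus (P.weights ?minus)"
      by (rule P.Nplus_converges(1)[OF A3 minus bspec[OF gd minus] na]) simp
    ultimately show ?thesis using const minus by blast
  qed
  have card_bij: "card (Nplus_limit_laws N d \<alpha> \<gamma> q \<phi>) = 2 ^ card P.A\<^sub>2"
    if "P.A\<^sub>3 = {}" "q < 1" "\<forall>\<eta>\<in>spin_configs. g_defined N d \<alpha> q (P.Splus \<eta>)"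
    using bij_betw_same_card[OF P.bij_Nplus_limit_laws[OF that(1,3,2)]] P.card_assignments by simp
  have stat: "\<exists>\<mu>. stationary N d \<alpha> \<gamma> q \<phi> \<mu> \<and> pmf \<mu> = joint_inf N d \<alpha> \<gamma> q \<phi> \<eta>"
    if "P.A\<^sub>3 = {}" "\<eta> \<in> spin_configs" "g_defined N d \<alpha> q (P.Splus \<eta>)" for \<eta>
    using P.joint_stationary[OF that] by blast
  have part_c: "\<not> (\<exists>v. \<forall>\<^sub>F n in sequentially. P.eta \<eta> n x = v)"
    if "\<phi> x \<in> P.A\<^sub>3" "\<eta> \<in> spin_configs" for \<eta> x
    using P.eta_A3_not_settling that by blast
  have A3_site: "\<exists>x. \<phi> x \<in> P.A\<^sub>3" if "P.A\<^sub>3 \<noteq> {}"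
  proof -
    obtain i where i: "i \<in> P.A\<^sub>3" using \<open>P.A\<^sub>3 \<noteq> {}\<close> by blast
    then have "i \<in> {1..N}" by (simp add: A3_def)
    then show ?thesis using P.\<phi>_inv[of i] i by metis
  qed
  show ?thesis
  proof (intro conjI impI ballI allI, goal_cases)
    case (1 k \<eta>)
    then show ?case using part_a by blast
  next
    case 2
    then show ?case using part_a by blast
  next
    case (3 \<eta>)
    then show ?case using settle by blast
  next
    case (4 \<eta> x)
    then show ?case using settle by blast
  next
    case (5 \<eta>)
    then show ?case using stat by blast
  next
    case (6 \<eta> k)
    then show ?case using P.Nplus_converges(2) by blast
  next
    case (7 \<eta> k)
    then show ?case using P.Nplus_converges(1) by blast
  next
    case 8
    then show ?case using P.card_joint_limit_laws by blast
  next
    case 9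
    then show ?case using differ by blast
  next
    case 10
    then show ?case using P.bij_Nplus_limit_laws by blast
  next
    case 11
    then show ?case using card_bij by blast
  next
    case (12 k \<eta> x)
    then show ?case using part_c by blast
  next
    case (13 k \<eta>)
    then show ?case using A3_site P.no_joint_limit by blast
  next
    case (14 k \<eta>)
    then show ?case using A3_site P.no_Nplus_limit by blast
  qed
qed

end
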